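(* Let $G$ be an arbitrary connected graph, let $0<p<\frac{1}{2}$ be a noise parameter and let $0<\delta<\frac{1}{2}$ be a confidence threshold. Suppose the target is drawn from a probability distribution $\mu$ on the vertices of $G$ that is given to the algorithm as input. There exists an adaptive Las Vegas graph searching algorithm (in the noisy graph search model described in the context) that, after an expected number of at most $$\frac{1}{I(p)}\left(H(\mu)+\log_2 \delta^{-1}+1\right)$$ queries, returns the target correctly with probability at least $1-\delta$.
   Context: Noisy graph search model: $G=(V,E)$ is an undirected, unweighted connected graph and $v^*\in V$ is an unknown target. In each step the algorithm queries a vertex $q$. A correct answer is "yes" if $q=v^*$, and otherwise is a neighbor $u$ of $q$ lying on a shortest path from $q$ to $v^*$. Each answer, independently, is erroneous with probability $p$ (in which case it may be an arbitrary different answer); otherwise it is correct. The algorithm is adaptive, and in the Las Vegas setting the number of queries is a random variable whose expectation is bounded (expectation over the target distribution and the noise). $H(\mu)=\sum_x \mu(x)\log_2\frac{1}{\mu(x)}$ is the entropy of $\mu$, $H(p)=-p\log_2 p-(1-p)\log_2(1-p)$ and $I(p)=1-H(p)$. *)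

theory Defs
  imports "HOL-Probability.Probability"
begin

section \<open>Graphs\<close>

text \<open>A finite undirected (simple) graph: vertex set V, symmetric irreflexive edge set E on V.\<close>
definition ugraph :: "'a set \<Rightarrow> ('a \<times> 'a) set \<Rightarrow> bool" where
  "ugraph V E \<longleftrightarrow> finite V \<and> E \<subseteq> V \<times> V \<and> sym E \<and> irrefl E"

definition connected_graph :: "'a set \<Rightarrow> ('a \<times> 'a) set \<Rightarrow> bool" where
  "connected_graph V E \<longleftrightarrow> ugraph V E \<and> V \<noteq> {} \<and> (\<forall>u\<in>V. \<forall>v\<in>V. (u, v) \<in> E\<^sup>*)"

text \<open>Graph distance (length of a shortest path).\<close>
definition gdist :: "('a \<times> 'a) set \<Rightarrow> 'a \<Rightarrow> 'a \<Rightarrow> nat" where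
  "gdist E u v = (LEAST n. (u, v) \<in> E ^^ n)"

section \<open>Queries and answers\<close>

text \<open>An answer to a query is either "yes" (None) or a vertex (Some u).\<close>
type_synonym 'a answer = "'a option"

definition valid_answer :: "('a \<times> 'a) set \<Rightarrow> 'a \<Rightarrow> 'a answer \<Rightarrow> bool" where
  "valid_answer E q a \<longleftrightarrow> a = None \<or> (\<exists>u. a = Some u \<and> (q, u) \<in> E)"

text \<open>Correct answer to query q when the target is v.\<close>
definition correct_answer :: "('a \<times> 'a) set \<Rightarrow> 'a \<Rightarrow> 'a \<Rightarrow> 'a answer \<Rightarrow> bool" where
  "correct_answer E v q a \<longleftrightarrow>
     (q = v \<and> a = None) \<or>
     (q \<noteq> v \<and> (\<exists>u. a = Some u \<and> (q, u) \<in> E \<and> gdist E u v + 1 = gdist E q v))"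

section \<open>Algorithms, noise and runs\<close>

type_synonym 'a history = "('a \<times> 'a answer) list"

datatype 'a action = Query 'a | Return 'a

text \<open>A (possibly randomised) adaptive algorithm: given the history of queries and answers,
  it either queries a vertex or stops and returns a vertex.\<close>
type_synonym 'a algorithm = "'a history \<Rightarrow> 'a action pmf"

definition wf_algorithm :: "'a set \<Rightarrow> 'a algorithm \<Rightarrow> bool" where
  "wf_algorithm V alg \<longleftrightarrow> (\<forall>h. \<forall>x\<in>set_pmf (alg h). case x of Query q \<Rightarrow> q \<in> V | Return r \<Rightarrow> r \<in> V)"

text \<open>The adversary resolves all non-random choices: for target v, history h and query q it
  picks the correct answer that is given (there may be several shortest paths) and the
  erroneous answer that is given in case of an error.\<close>
type_synonym 'a adversary = "'a \<Rightarrow> 'a history \<Rightarrow> 'a \<Rightarrow> 'a answer \<times> 'a answer"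

definition wf_adversary :: "'a set \<Rightarrow> ('a \<times> 'a) set \<Rightarrow> 'a adversary \<Rightarrow> bool" where
  "wf_adversary V E adv \<longleftrightarrow>
     (\<forall>v\<in>V. \<forall>h. \<forall>q\<in>V.
        correct_answer E v q (fst (adv v h q)) \<and>
        valid_answer E q (snd (adv v h q)) \<and>
        snd (adv v h q) \<noteq> fst (adv v h q))"

text \<open>Probability of a given answer: correct with probability 1-p, erroneous with probability p.\<close>
definition answer_prob :: "real \<Rightarrow> 'a answer \<times> 'a answer \<Rightarrow> 'a answer \<Rightarrow> real" where
  "answer_prob p ce a = (if a = fst ce then 1 - p else 0) + (if a = snd ce then p else 0)"

text \<open>Probability that the run (for target v) produces exactly the history h (as its first
  length h query/answer pairs).\<close>
definition path_prob :: "'a algorithm \<Rightarrow> 'a adversary \<Rightarrow> real \<Rightarrow> 'a \<Rightarrow> 'a history \<Rightarrow> real" where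
  "path_prob alg adv p v h =
     (\<Prod>i<length h. pmf (alg (take i h)) (Query (fst (h ! i))) *
                    answer_prob p (adv v (take i h) (fst (h ! i))) (snd (h ! i)))"

text \<open>Probability that the run stops after history h and returns r.\<close>
definition term_prob :: "'a algorithm \<Rightarrow> 'a adversary \<Rightarrow> real \<Rightarrow> 'a \<Rightarrow> 'a history \<Rightarrow> 'a \<Rightarrow> real" where
  "term_prob alg adv p v h r = path_prob alg adv p v h * pmf (alg h) (Return r)"

text \<open>Probability (over target and noise) that the algorithm terminates.\<close>
definition termination_prob :: "'a pmf \<Rightarrow> 'a algorithm \<Rightarrow> 'a adversary \<Rightarrow> real \<Rightarrow> ennreal" where
  "termination_prob \<mu> alg adv p =
     (\<integral>\<^sup>+ v. (\<integral>\<^sup>+ hr. ennreal (term_prob alg adv p v (fst hr) (snd hr)) \<partial>count_space UNIV) \<partial>measure_pmf \<mu>)"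

text \<open>Expected number of queries (over target and noise).\<close>
definition expected_queries :: "'a pmf \<Rightarrow> 'a algorithm \<Rightarrow> 'a adversary \<Rightarrow> real \<Rightarrow> ennreal" where
  "expected_queries \<mu> alg adv p =
     (\<integral>\<^sup>+ v. (\<integral>\<^sup>+ hr. ennreal (term_prob alg adv p v (fst hr) (snd hr)) * of_nat (length (fst hr))
              \<partial>count_space UNIV) \<partial>measure_pmf \<mu>)"

text \<open>Probability (over target and noise) that the algorithm returns the target.\<close>
definition success_prob :: "'a pmf \<Rightarrow> 'a algorithm \<Rightarrow> 'a adversary \<Rightarrow> real \<Rightarrow> ennreal" where
  "success_prob \<mu> alg adv p =
     (\<integral>\<^sup>+ v. (\<integral>\<^sup>+ h. ennreal (term_prob alg adv p v h v) \<partial>count_space UNIV) \<partial>measure_pmf \<mu>)"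

section \<open>Entropy\<close>

definition entropy_pmf :: "'a set \<Rightarrow> 'a pmf \<Rightarrow> real" where
  "entropy_pmf V \<mu> = (\<Sum>x\<in>V. if pmf \<mu> x = 0 then 0 else pmf \<mu> x * log 2 (1 / pmf \<mu> x))"

definition bin_entropy :: "real \<Rightarrow> real" where
  "bin_entropy p = - p * log 2 p - (1 - p) * log 2 (1 - p)"

definition info_cap :: "real \<Rightarrow> real" where
  "info_cap p = 1 - bin_entropy p"

end

theory Submission
  imports Defs
begin

text \<open>
  Every vertex carries a weight, initially its prior probability. As long as no vertex has half of
  the total weight, the algorithm queries the weighted median of the graph. Every answer is then
  consistent with at most half of the weight; multiplying consistent weights by \<open>1 - p\<close> and the others
  by \<open>p\<close> therefore raises the logarithm of the target's share of the weight by at least \<open>I(p)\<close> in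
  expectation.

  The weights alone must not decide when to stop: the erroneous answer may depend on the target, so the
  weights are not posterior probabilities, and the adversary can make the same wrong vertex heavy
  again and again. Instead a heavy vertex \<open>r\<close> becomes a candidate and is queried until the yes
  answers lead by a threshold (\<open>r\<close> is returned) or the no answers lead by one (the weight of \<open>r\<close> is
  divided by \<open>L = (1 - p) / p\<close>). A wrong candidate receives yes with probability at most \<open>p\<close>, whatever
  the adversary does, so gambler's ruin bounds the error of each test, and the thresholds
  grow with the number of rejections such that the errors add up to at most \<open>\<delta>\<close>.

  The growing thresholds are paid for as follows. Rejecting a wrong candidate raises the share of the
  target by more than the queries of its test are worth at rate \<open>I(p)\<close>, which leaves a fixed refund per
  rejection. On the true target the log-odds in a test grow by \<open>(1 - 2 * p) * log 2 L\<close> per query, which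
  is at least \<open>4 * I(p)\<close>, so \<open>log 2 (1 / \<delta>) + 1\<close> plus the refunds suffices for the final test.
\<close>

section \<open>Inequalities for the capacity\<close>

lemma ln_one_minus_le: fixes x :: real assumes "0 \<le> x" "x < 1" shows "ln (1 - x) \<le> - x"
  using ln_add_one_self_le_self2[of "-x"] assms by simp

lemma has_derivative_x_ln_x:
  fixes t :: real
  assumes "0 \<le> t" "t < 1"
  shows "((\<lambda>x. (1 + x) * ln (1 + x) + (1 - x) * ln (1 - x)) has_real_derivative
           ln (1 + t) - ln (1 - t)) (at t)"
proof -
  have "((\<lambda>x. (1 + x) * ln (1 + x)) has_real_derivative ln (1 + t) + 1) (at t)"
    using assms by (auto intro!: derivative_eq_intros)
  moreover have "((\<lambda>x. (1 - x) * ln (1 - x)) has_real_derivative - ln (1 - t) - 1) (at t)"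
    using assms by (auto intro!: derivative_eq_intros)
  ultimately show ?thesis using DERIV_add by fastforce
qed

text \<open>At \<open>x = 1 - 2 * p\<close> the right side is \<open>2 * ln 2 * info_cap p\<close>
  (\<open>info_cap_ln\<close>), so this is a quadratic lower bound on the capacity. Value and first
  derivative agree at 0; the second derivatives compare by
  \<open>1 / (1 + u) + 1 / (1 - u) \<ge> 2\<close>.\<close>

lemma entropy_gap_ge_square:
  fixes x :: real assumes "0 \<le> x" "x < 1"
  shows "x\<^sup>2 \<le> (1 + x) * ln (1 + x) + (1 - x) * ln (1 - x)"
proof -
  let ?f = "\<lambda>x::real. (1 + x) * ln (1 + x) + (1 - x) * ln (1 - x) - x\<^sup>2"
  have "?f 0 \<le> ?f x"
  proof (rule DERIV_nonneg_imp_nondecreasing[OF assms(1)])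
    fix t :: real assume t: "0 \<le> t" "t \<le> x"
    hence "t < 1" using assms by simp
    have "(?f has_real_derivative (ln (1 + t) - ln (1 - t) - 2 * t)) (at t)"
      by (intro DERIV_diff has_derivative_x_ln_x) (use t \<open>t < 1\<close> in \<open>auto intro!: derivative_eq_intros\<close>)
    moreover have "ln (1 + t) - ln (1 - t) - 2 * t \<ge> 0"
    proof -
      let ?g = "\<lambda>x::real. ln (1 + x) - ln (1 - x) - 2 * x"
      have "?g 0 \<le> ?g t"
      proof (rule DERIV_nonneg_imp_nondecreasing[OF t(1)])
        fix u :: real assume u: "0 \<le> u" "u \<le> t"
        hence u1: "u < 1" using \<open>t < 1\<close> by simp
        have "(?g has_real_derivative (1 / (1 + u) + 1 / (1 - u) - 2)) (at u)"
          using u u1 by (auto intro!: derivative_eq_intros)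
        moreover have "1 - u \<le> 1 / (1 + u)" "1 + u \<le> 1 / (1 - u)"
          using u u1 by (simp_all add: pos_le_divide_eq algebra_simps del: le_divide_eq_1_pos diff_le_eq)
        hence "1 / (1 + u) + 1 / (1 - u) - 2 \<ge> 0" by simp
        ultimately show "\<exists>y. (?g has_real_derivative y) (at u) \<and> 0 \<le> y" by blast
      qed
      thus ?thesis by simp
    qed
    ultimately show "\<exists>y. (?f has_real_derivative y) (at t) \<and> 0 \<le> y" by blast
  qed
  thus ?thesis by simp
qed

text \<open>At \<open>x = 1 - 2 * p\<close> this becomes \<open>log_odds_ge_yield\<close>. The
  difference of the two sides and its first derivative vanish at 0, and its second derivative is
  nonnegative.\<close>

lemma log_odds_ge_entropy_gap:
  fixes x :: real assumes "0 \<le> x" "x < 1"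
  shows "2 * ((1 + x) * ln (1 + x) + (1 - x) * ln (1 - x)) \<le> x * (ln (1 + x) - ln (1 - x))"
proof -
  let ?f = "\<lambda>x::real. x * (ln (1 + x) - ln (1 - x)) - 2 * ((1 + x) * ln (1 + x) + (1 - x) * ln (1 - x))"
  have "?f 0 \<le> ?f x"
  proof (rule DERIV_nonneg_imp_nondecreasing[OF assms(1)])
    fix t :: real assume t: "0 \<le> t" "t \<le> x"
    hence "t < 1" using assms by simp
    have "((\<lambda>x. x * (ln (1 + x) - ln (1 - x))) has_real_derivative
            (ln (1 + t) - ln (1 - t)) + t * (1 / (1 + t) + 1 / (1 - t))) (at t)"
      using t \<open>t < 1\<close> by (auto intro!: derivative_eq_intros)
    from DERIV_diff[OF this DERIV_cmult[OF has_derivative_x_ln_x[OF t(1) \<open>t < 1\<close>], of 2]]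
    have "(?f has_real_derivative (t * (1 / (1 + t) + 1 / (1 - t)) - (ln (1 + t) - ln (1 - t)))) (at t)"
      by (simp add: algebra_simps)
    moreover have "t * (1 / (1 + t) + 1 / (1 - t)) - (ln (1 + t) - ln (1 - t)) \<ge> 0"
    proof -
      let ?g = "\<lambda>t::real. t * (1 / (1 + t) + 1 / (1 - t)) - (ln (1 + t) - ln (1 - t))"
      have "?g 0 \<le> ?g t"
      proof (rule DERIV_nonneg_imp_nondecreasing[OF t(1)])
        fix u :: real assume u: "0 \<le> u" "u \<le> t"
        hence u1: "u < 1" using \<open>t < 1\<close> by simp
        have "(?g has_real_derivative (1 / (1 + u) + 1 / (1 - u))
                + u * (1 / (1 - u)\<^sup>2 - 1 / (1 + u)\<^sup>2) - (1 / (1 + u) + 1 / (1 - u))) (at u)"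
          using u u1 by (auto intro!: derivative_eq_intros simp: power2_eq_square)
        hence "(?g has_real_derivative (u * (1 / (1 - u)\<^sup>2 - 1 / (1 + u)\<^sup>2))) (at u)" by simp
        moreover have "u * (1 / (1 - u)\<^sup>2 - 1 / (1 + u)\<^sup>2) \<ge> 0"
        proof -
          have "(1 - u)\<^sup>2 \<le> (1 + u)\<^sup>2" using u u1 by (simp add: power_mono)
          hence "1 / (1 + u)\<^sup>2 \<le> 1 / (1 - u)\<^sup>2" using u u1 by (intro divide_left_mono) auto
          thus ?thesis using u by simp
        qed
        ultimately show "\<exists>y. (?g has_real_derivative y) (at u) \<and> 0 \<le> y" by blast
      qed
      thus ?thesis by simp
    qed
    ultimately show "\<exists>y. (?f has_real_derivative y) (at t) \<and> 0 \<le> y" by blast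
  qed
  thus ?thesis by simp
qed

text \<open>Bernoulli's inequality in logarithmic form. If \<open>z\<close> are the odds against the
  target, \<open>L * z\<close> are the odds after the target has been demoted by mistake.\<close>

lemma log_one_plus_scaled_le:
  fixes L z :: real assumes "1 \<le> L" "0 \<le> z"
  shows "log 2 (1 + L * z) \<le> L * log 2 (1 + z)"
proof -
  let ?f = "\<lambda>z::real. L * ln (1 + z) - ln (1 + L * z)"
  have "?f 0 \<le> ?f z"
  proof (rule DERIV_nonneg_imp_nondecreasing[OF assms(2)])
    fix t :: real assume t: "0 \<le> t" "t \<le> z"
    have pos: "1 + L * t > 0" using t assms by (simp add: add_pos_nonneg)
    have "(?f has_real_derivative (L * (1 / (1 + t)) - L * (1 / (1 + L * t)))) (at t)"
      using t pos by (auto intro!: derivative_eq_intros)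
    moreover have "L * (1 / (1 + t)) - L * (1 / (1 + L * t)) \<ge> 0"
    proof -
      have "1 + t \<le> 1 + L * t" using t assms mult_right_mono[of 1 L t] by simp
      hence "1 / (1 + L * t) \<le> 1 / (1 + t)" using t pos by (intro divide_left_mono) auto
      thus ?thesis using assms mult_left_mono[of "1 / (1 + L * t)" "1 / (1 + t)" L] by simp
    qed
    ultimately show "\<exists>y. (?f has_real_derivative y) (at t) \<and> 0 \<le> y" by blast
  qed
  thus ?thesis by (simp add: log_def divide_right_mono)
qed

lemma info_cap_ln:
  fixes p :: real assumes "0 < p" "p < 1/2"
  shows "2 * ln 2 * info_cap p = (2 - 2 * p) * ln (2 - 2 * p) + 2 * p * ln (2 * p)"
proof -
  have "ln (2 - 2 * p) = ln 2 + ln (1 - p)" using ln_mult[of 2 "1-p"] assms by (simp add: algebra_simps)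
  moreover have "ln (2 * p) = ln 2 + ln p" using assms by (simp add: ln_mult)
  ultimately show ?thesis
    unfolding info_cap_def bin_entropy_def log_def by (simp add: field_simps)
qed

text \<open>Asking about a wrong candidate repeatedly, until the no answers lead by one, takes at most
  \<open>1 / (1 - 2 * p)\<close> queries in expectation, so \<open>yield p\<close> is the information that these queries have
  to bring in. \<open>refund p\<close> is a lower bound for what the rejection gains beyond that
  (\<open>yield_plus_refund_le\<close>).\<close>

definition yield :: "real \<Rightarrow> real" where "yield p = info_cap p / (1 - 2 * p)"
definition refund :: "real \<Rightarrow> real" where "refund p = p * (1 - 2 * p) / ln 2"

context
  fixes p :: real
  assumes p: "0 < p" "p < 1/2"
begin

lemma yield_ln:
  "2 * ln 2 * (1 - 2 * p) * yield p = (2 - 2 * p) * ln (2 - 2 * p) + 2 * p * ln (2 * p)"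
  using info_cap_ln[OF p] p by (simp add: yield_def)

lemma refund_pos: "0 < refund p" using p by (simp add: refund_def)

lemma refund_le_yield: "refund p \<le> yield p"
proof -
  have "(1 - 2 * p)\<^sup>2 \<le> 2 * ln 2 * (1 - 2 * p) * yield p"
    using entropy_gap_ge_square[of "1 - 2 * p"] p unfolding yield_ln by (simp add: algebra_simps)
  hence "(1 - 2 * p) * (1 - 2 * p) \<le> (1 - 2 * p) * (2 * ln 2 * yield p)"
    by (simp add: power2_eq_square algebra_simps)
  hence "1 - 2 * p \<le> 2 * ln 2 * yield p" using p by simp
  moreover have "2 * p * (1 - 2 * p) \<le> 1 * (1 - 2 * p)"
    using p by (intro mult_right_mono) auto
  ultimately show ?thesis by (simp add: refund_def field_simps)
qed

lemma yield_pos: "0 < yield p" using refund_pos refund_le_yield by simp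

lemma info_cap_pos: "0 < info_cap p" using yield_pos p by (simp add: yield_def zero_less_divide_iff)

text \<open>The right side is the least gain in the target's log-share when a wrong heavy vertex is
  demoted. Adding \<open>- 2 * p * ln (1 - x\<^sup>2)\<close> for \<open>x = 1 - 2 * p\<close>
  cancels the term with \<open>ln (2 * p)\<close>, as
  \<open>1 - x\<^sup>2 = (2 - 2 * p) * (2 * p)\<close>.\<close>

lemma yield_plus_refund_le: "yield p + refund p \<le> log 2 (2 * (1 - p))"
proof -
  let ?x = "1 - 2 * p"
  have "ln (1 - ?x\<^sup>2) \<le> - (?x\<^sup>2)"
    using p by (intro ln_one_minus_le) (auto simp: abs_square_less_1)
  moreover have "1 - ?x\<^sup>2 = (2 - 2 * p) * (2 * p)" by (simp add: power2_eq_square algebra_simps)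
  ultimately have 1: "ln (2 - 2 * p) + ln (2 * p) \<le> - (?x\<^sup>2)" using p by (simp add: ln_mult)
  have "2 * ?x * (ln 2 * yield p + p * ?x) = (2 - 2 * p) * ln (2 - 2 * p) + 2 * p * ln (2 * p) + 2 * p * ?x\<^sup>2"
    using yield_ln by (simp add: algebra_simps power2_eq_square)
  also have "\<dots> \<le> (2 - 2 * p) * ln (2 - 2 * p) + 2 * p * ln (2 * p) - 2 * p * (ln (2 - 2 * p) + ln (2 * p))"
    using mult_left_mono[OF 1, of "2 * p"] p by simp
  also have "\<dots> = 2 * ?x * ln (2 - 2 * p)" by (simp add: algebra_simps)
  finally have "ln 2 * yield p + p * ?x \<le> ln (2 - 2 * p)" using p by simp
  hence "(ln 2 * yield p + p * ?x) / ln 2 \<le> ln (2 - 2 * p) / ln 2" by (intro divide_right_mono) auto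
  thus ?thesis by (simp add: refund_def log_def add_divide_distrib right_diff_distrib)
qed

lemma yield_le_one: "yield p \<le> 1"
proof -
  have "log 2 (2 * (1 - p)) \<le> log 2 2" using p by (subst log_le_cancel_iff) auto
  thus ?thesis using yield_plus_refund_le refund_pos by simp
qed

lemma log_odds_ge_yield: "4 * yield p \<le> log 2 ((1 - p) / p)"
proof -
  let ?x = "1 - 2 * p"
  have "2 * (2 * ln 2 * ?x * yield p) \<le> ?x * (ln (2 - 2 * p) - ln (2 * p))"
    using log_odds_ge_entropy_gap[of ?x] p unfolding yield_ln by (simp add: algebra_simps)
  hence "?x * (4 * ln 2 * yield p) \<le> ?x * (ln (2 - 2 * p) - ln (2 * p))" by (simp add: algebra_simps)
  hence "4 * ln 2 * yield p \<le> ln (2 - 2 * p) - ln (2 * p)" using p by simp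
  also have "\<dots> = ln ((1 - p) / p)" using p ln_mult[of 2 "1-p"] by (simp add: ln_div ln_mult algebra_simps)
  finally show ?thesis by (simp add: log_def field_simps)
qed

text \<open>This becomes \<open>tail_step\<close> at \<open>k = 0\<close>, with a real exponent in
  place of the rounded threshold: the gambler's ruin probability of the first test is at most the
  error set aside for it.\<close>

lemma odds_tail_bound:
  defines "L \<equiv> (1 - p) / p"
  assumes "0 < \<delta>" "\<delta> < 1/2"
  shows "L - 1 \<le> \<delta> * (L powr ((log 2 (1 / \<delta>) + 1) / yield p) - 1) * (1 - L powr (- refund p / yield p))"
proof -
  define K where "K = log 2 L / yield p"
  define z where "z = K * refund p * ln 2"
  have L1: "1 < L" using p by (simp add: L_def field_simps)
  have K4: "4 \<le> K" using log_odds_ge_yield yield_pos by (simp add: K_def L_def field_simps)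
  have KL: "log 2 L \<le> K" using L1 yield_le_one yield_pos by (simp add: K_def field_simps)
  have zp: "0 < z" using K4 refund_pos by (simp add: z_def)
  have L2: "L = 2 powr log 2 L" using L1 by simp
  have e: "L powr (- refund p / yield p) = exp (- z)"
    using L1 by (simp add: powr_def z_def K_def log_def)
  have "1 + z \<le> exp z" by simp
  hence "exp (- z) \<le> 1 / (1 + z)" using zp by (simp add: exp_minus field_simps)
  hence ez: "z / (1 + z) \<le> 1 - exp (- z)" using zp by (simp add: field_simps)
  \<comment> \<open>Base and exponent are exchanged because \<open>2 / \<delta>\<close> exceeds 4,
    so that powers of 4 bound the result from below.\<close>
  have A: "L powr ((log 2 (1 / \<delta>) + 1) / yield p) = (2 / \<delta>) powr K"
    using L1 assms(2) by (simp add: powr_def K_def log_def ln_div field_simps)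
  have "4 powr (K - 1) * (2 / \<delta>) \<le> (2 / \<delta>) powr (K - 1) * (2 / \<delta>)"
    using assms K4 by (intro mult_right_mono powr_mono2) (auto simp: field_simps)
  also have "\<dots> = (2 / \<delta>) powr K" using assms(2) by (simp add: powr_diff)
  finally have "\<delta> * (4 powr (K - 1) * (2 / \<delta>)) \<le> \<delta> * (2 / \<delta>) powr K"
    using assms by (intro mult_left_mono) auto
  hence dA: "4 powr K / 2 \<le> \<delta> * (2 / \<delta>) powr K" using assms(2) by (simp add: powr_diff)
  \<comment> \<open>\<open>p = 1 / (L + 1)\<close> makes the refund, up to \<open>ln 2\<close>, a
    rational function of \<open>L\<close>.\<close>
  have rz: "z = K * (L - 1) / (L + 1)\<^sup>2"
  proof -
    have "L + 1 = 1 / p" "L - 1 = (1 - 2 * p) / p" using p by (auto simp: L_def field_simps)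
    thus ?thesis using p by (simp add: z_def refund_def power2_eq_square)
  qed
  have fourL: "L\<^sup>2 \<le> 4 powr K"
  proof -
    have "L\<^sup>2 = 2 powr log 2 L * 2 powr log 2 L" using L1 by (simp add: power2_eq_square)
    also have "\<dots> = 4 powr log 2 L" by (subst powr_mult[symmetric]) auto
    also have "\<dots> \<le> 4 powr K" using KL by simp
    finally show ?thesis .
  qed
  have four4: "256 \<le> 4 powr K"
  proof -
    have "(256::real) = 4 powr 4" by simp
    also have "\<dots> \<le> 4 powr K" using K4 by (intro powr_mono) auto
    finally show ?thesis .
  qed
  \<comment> \<open>Up to 16 the constant 256 suffices, since \<open>15 + 17 ^ 2 / 4\<close> is
    below \<open>255 / 2\<close>; for larger \<open>L\<close> the quadratic bound
    \<open>fourL\<close> takes over.\<close>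
  have q: "L - 1 + (L + 1)\<^sup>2 / 4 \<le> (4 powr K - 1) / 2"
  proof (cases "L \<le> 16")
    case True
    have "(L + 1)\<^sup>2 \<le> 17\<^sup>2" using True L1 by (intro power_mono) auto
    thus ?thesis using True four4 by simp
  next
    case False
    have "L * 16 \<le> L * L" using False by (intro mult_left_mono) auto
    hence M: "16 * L \<le> L\<^sup>2" by (simp add: power2_eq_square)
    have "(L + 1)\<^sup>2 = L\<^sup>2 + 2 * L + 1" by (simp add: power2_sum)
    hence "L - 1 + (L + 1)\<^sup>2 / 4 = (L\<^sup>2 + 6 * L - 3) / 4" by (simp add: field_simps)
    also have "\<dots> \<le> (L\<^sup>2 + L\<^sup>2 - 2) / 4" using M False by (intro divide_right_mono) linarith+
    also have "\<dots> \<le> (4 powr K - 1) / 2" using fourL by simp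
    finally show ?thesis .
  qed
  have "(L - 1) * (1 + 1 / z) = L - 1 + (L + 1)\<^sup>2 / K"
    using L1 K4 by (simp add: rz field_simps)
  also have "\<dots> \<le> L - 1 + (L + 1)\<^sup>2 / 4" using K4 by (intro add_left_mono divide_left_mono) auto
  also note q
  also have "(4 powr K - 1) / 2 \<le> \<delta> * ((2 / \<delta>) powr K - 1)"
    using dA assms(3) by (simp add: right_diff_distrib diff_divide_distrib)
  finally have "(L - 1) * (1 + 1 / z) * (z / (1 + z)) \<le> \<delta> * ((2 / \<delta>) powr K - 1) * (z / (1 + z))"
    using zp by (intro mult_right_mono) auto
  also have "(L - 1) * (1 + 1 / z) * (z / (1 + z)) = L - 1"
  proof -
    have "1 + 1 / z = (1 + z) / z" using zp by (simp add: field_simps)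
    thus ?thesis using zp by simp
  qed
  also have "\<delta> * ((2 / \<delta>) powr K - 1) * (z / (1 + z)) \<le> \<delta> * ((2 / \<delta>) powr K - 1) * (1 - exp (- z))"
  proof (intro mult_left_mono ez mult_nonneg_nonneg)
    show "0 \<le> (2 / \<delta>) powr K - 1" using assms K4 ge_one_powr_ge_zero[of "2/\<delta>" K] by simp
  qed (use assms in auto)
  finally show ?thesis unfolding e A .
qed

end

section \<open>Weighted medians\<close>

lemma gdist_edge_le:
  assumes "connected_graph V E" "(q, u) \<in> E" "v \<in> V"
  shows "gdist E u v \<le> gdist E q v + 1"
proof -
  have "q \<in> V" "(u, q) \<in> E"
    using assms by (auto simp: connected_graph_def ugraph_def sym_def)
  hence "(q, v) \<in> E\<^sup>*" using assms by (auto simp: connected_graph_def)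
  then obtain n where "(q, v) \<in> E ^^ n" using rtrancl_imp_relpow by blast
  hence "(q, v) \<in> E ^^ gdist E q v" unfolding gdist_def by (rule LeastI)
  with \<open>(u, q) \<in> E\<close> have "(u, v) \<in> E ^^ Suc (gdist E q v)" by (rule relpow_Suc_I2)
  thus ?thesis unfolding gdist_def by (simp add: Least_le)
qed

definition median :: "'a set \<Rightarrow> ('a \<times> 'a) set \<Rightarrow> ('a \<Rightarrow> real) \<Rightarrow> 'a" where
  "median V E w = (ARG_MIN (\<lambda>q. \<Sum>v\<in>V. real (gdist E q v) * w v) q. q \<in> V)"

lemma median_props:
  assumes "connected_graph V E"
  shows "median V E w \<in> V"
    and "u \<in> V \<Longrightarrow> (\<Sum>v\<in>V. real (gdist E (median V E w) v) * w v) \<le> (\<Sum>v\<in>V. real (gdist E u v) * w v)"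
proof -
  have "finite V" "V \<noteq> {}" using assms by (auto simp: connected_graph_def ugraph_def)
  from arg_min_if_finite[OF this, of "\<lambda>q. \<Sum>v\<in>V. real (gdist E q v) * w v"]
  show "median V E w \<in> V"
    and "u \<in> V \<Longrightarrow> (\<Sum>v\<in>V. real (gdist E (median V E w) v) * w v) \<le> (\<Sum>v\<in>V. real (gdist E u v) * w v)"
    unfolding median_def arg_min_on_def by (auto simp: not_less)
qed

text \<open>Moving from the median to \<open>u\<close> shortens the distance to the vertices of this
  set by one and lengthens any other by at most one. With more than half of the weight in the set,
  \<open>u\<close> would beat the median.\<close>

lemma median_neighbour_le_half:
  assumes "connected_graph V E" and nonneg: "\<And>v. v \<in> V \<Longrightarrow> 0 \<le> w v"
    and qu: "(median V E w, u) \<in> E"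
  shows "2 * sum w {v \<in> V. gdist E u v + 1 = gdist E (median V E w) v} \<le> sum w V"
proof -
  define q where "q = median V E w"
  let ?C = "{v \<in> V. gdist E u v + 1 = gdist E q v}"
  have fin: "finite V" and u: "u \<in> V"
    using assms(1) qu by (auto simp: connected_graph_def ugraph_def)
  have "(\<Sum>v\<in>V. real (gdist E q v) * w v) \<le> (\<Sum>v\<in>V. real (gdist E u v) * w v)"
    unfolding q_def using median_props(2)[OF assms(1) u] .
  also have "\<dots> \<le> (\<Sum>v\<in>V. real (gdist E q v) * w v + w v - (if v \<in> ?C then 2 * w v else 0))"
  proof (rule sum_mono)
    fix v assume v: "v \<in> V"
    have "gdist E u v \<le> gdist E q v + 1"
      using gdist_edge_le[OF assms(1) _ v] qu by (simp add: q_def)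
    hence "real (gdist E u v) \<le> real (gdist E q v) + 1 - (if v \<in> ?C then 2 else 0)"
      using v by auto
    from mult_right_mono[OF this nonneg[OF v]]
    show "real (gdist E u v) * w v \<le> real (gdist E q v) * w v + w v - (if v \<in> ?C then 2 * w v else 0)"
      by (auto simp: algebra_simps)
  qed
  also have "\<dots> = (\<Sum>v\<in>V. real (gdist E q v) * w v) + sum w V - (\<Sum>v\<in>V. if v \<in> ?C then 2 * w v else 0)"
    by (simp add: sum.distrib sum_subtractf)
  also have "(\<Sum>v\<in>V. if v \<in> ?C then 2 * w v else 0) = (\<Sum>v\<in>?C. 2 * w v)"
    using fin by (intro sum.mono_neutral_cong_right) auto
  finally show ?thesis by (simp add: q_def sum_distrib_left)
qed

text \<open>A yes is consistent with the median alone, which is light by assumption; a neighbour is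
  handled by the minimality of the median.\<close>

lemma consistent_le_half:
  assumes "connected_graph V E" and nonneg: "\<And>v. v \<in> V \<Longrightarrow> 0 \<le> w v"
    and light: "\<And>v. v \<in> V \<Longrightarrow> 2 * w v \<le> sum w V"
    and "valid_answer E (median V E w) a"
  shows "2 * sum w {v \<in> V. correct_answer E v (median V E w) a} \<le> sum w V"
proof (cases a)
  case None
  have "{v \<in> V. correct_answer E v (median V E w) a} = {median V E w}"
    using None median_props(1)[OF assms(1)] by (auto simp: correct_answer_def)
  thus ?thesis using light[OF median_props(1)[OF assms(1)]] by simp
next
  case (Some u)
  hence qu: "(median V E w, u) \<in> E" using assms(4) by (simp add: valid_answer_def)
  have "finite V" using assms(1) by (simp add: connected_graph_def ugraph_def)
  hence "sum w {v \<in> V. correct_answer E v (median V E w) a}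
      \<le> sum w {v \<in> V. gdist E u v + 1 = gdist E (median V E w) v}"
    using Some nonneg by (intro sum_mono2) (auto simp: correct_answer_def)
  thus ?thesis using median_neighbour_le_half[OF assms(1) nonneg qu] by simp
qed

section \<open>Runs of deterministic algorithms\<close>

lemma path_prob_Nil [simp]: "path_prob alg adv p v [] = 1"
  by (simp add: path_prob_def)

lemma path_prob_snoc:
  "path_prob alg adv p v (h @ [x]) =
     path_prob alg adv p v h * (pmf (alg h) (Query (fst x)) * answer_prob p (adv v h (fst x)) (snd x))"
proof -
  have "path_prob alg adv p v (h @ [x]) = (\<Prod>i<Suc (length h).
      pmf (alg (take i (h @ [x]))) (Query (fst ((h @ [x]) ! i))) *
      answer_prob p (adv v (take i (h @ [x])) (fst ((h @ [x]) ! i))) (snd ((h @ [x]) ! i)))"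
    by (simp add: path_prob_def)
  also have "\<dots> = (\<Prod>i<length h.
      pmf (alg (take i (h @ [x]))) (Query (fst ((h @ [x]) ! i))) *
      answer_prob p (adv v (take i (h @ [x])) (fst ((h @ [x]) ! i))) (snd ((h @ [x]) ! i))) *
      (pmf (alg h) (Query (fst x)) * answer_prob p (adv v h (fst x)) (snd x))"
    by simp
  also have "(\<Prod>i<length h.
      pmf (alg (take i (h @ [x]))) (Query (fst ((h @ [x]) ! i))) *
      answer_prob p (adv v (take i (h @ [x])) (fst ((h @ [x]) ! i))) (snd ((h @ [x]) ! i)))
    = path_prob alg adv p v h"
    unfolding path_prob_def by (intro prod.cong) (auto simp: nth_append)
  finally show ?thesis .
qed

text \<open>With the target fixed and the actions deterministic, the noise is the only randomness
  left; averaging over the target is postponed to the end.\<close>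

locale deterministic_run =
  fixes V :: "'a set" and E :: "('a \<times> 'a) set" and p :: real
    and act :: "'a history \<Rightarrow> 'a action" and adv :: "'a adversary" and v :: 'a
  assumes conn: "connected_graph V E"
    and p: "0 < p" "p < 1/2"
    and act_in: "\<And>h. case act h of Query q \<Rightarrow> q \<in> V | Return r \<Rightarrow> r \<in> V"
    and adv: "wf_adversary V E adv"
    and target: "v \<in> V"
begin

definition P :: "'a history \<Rightarrow> real" where
  "P = path_prob (\<lambda>h. return_pmf (act h)) adv p v"

definition good :: "'a history \<Rightarrow> 'a \<Rightarrow> 'a history" where
  "good h q = h @ [(q, fst (adv v h q))]"

definition bad :: "'a history \<Rightarrow> 'a \<Rightarrow> 'a history" where
  "bad h q = h @ [(q, snd (adv v h q))]"

lemma P_Nil [simp]: "P [] = 1" by (simp add: P_def)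

lemma P_snoc [simp]:
  "P (h @ [(q, a)]) = (if act h = Query q then P h * answer_prob p (adv v h q) a else 0)"
  by (simp add: P_def path_prob_snoc)

section \<open>Finite sums over the histories of a fixed length\<close>

definition hist :: "nat \<Rightarrow> 'a history set" where
  "hist n = {h. set h \<subseteq> V \<times> insert None (Some ` V) \<and> length h = n}"

lemma finite_V: "finite V" using conn by (simp add: connected_graph_def ugraph_def)

lemma finite_hist: "finite (hist n)"
  unfolding hist_def by (intro finite_lists_length_eq) (simp add: finite_V)

lemma hist_0: "hist 0 = {[]}" by (auto simp: hist_def)

lemma sum_hist_Suc:
  "sum f (hist (Suc n)) = (\<Sum>h\<in>hist n. \<Sum>x\<in>V \<times> insert None (Some ` V). f (h @ [x]))"
proof -
  have "bij_betw (\<lambda>(h, x). h @ [x]) (hist n \<times> (V \<times> insert None (Some ` V))) (hist (Suc n))"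
  proof (rule bij_betwI[where g = "\<lambda>h. (butlast h, last h)"])
    show "(\<lambda>h. (butlast h, last h)) \<in> hist (Suc n) \<rightarrow> hist n \<times> V \<times> insert None (Some ` V)"
    proof
      fix h assume h: "h \<in> hist (Suc n)"
      hence "h \<noteq> []" by (auto simp: hist_def)
      with h show "(butlast h, last h) \<in> hist n \<times> V \<times> insert None (Some ` V)"
        unfolding hist_def using last_in_set[OF \<open>h \<noteq> []\<close>]
        by (auto dest: in_set_butlastD)
    qed
  qed (auto simp: hist_def length_Suc_conv_rev)
  from sum.reindex_bij_betw[OF this, of f]
  show ?thesis by (simp add: sum.cartesian_product split_def)
qed

lemma valid_in: "q \<in> V \<Longrightarrow> valid_answer E q a \<Longrightarrow> a \<in> insert None (Some ` V)"
  using conn by (auto simp: valid_answer_def connected_graph_def ugraph_def)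

lemma adv_props:
  assumes "q \<in> V"
  shows "correct_answer E v q (fst (adv v h q))" "valid_answer E q (fst (adv v h q))"
    "valid_answer E q (snd (adv v h q))" "snd (adv v h q) \<noteq> fst (adv v h q)"
proof -
  show *: "correct_answer E v q (fst (adv v h q))"
    "valid_answer E q (snd (adv v h q))" "snd (adv v h q) \<noteq> fst (adv v h q)"
    using adv assms target by (auto simp: wf_adversary_def)
  show "valid_answer E q (fst (adv v h q))"
    using *(1) by (auto simp: valid_answer_def correct_answer_def)
qed

text \<open>Only the two answers of the adversary have positive probability, and they differ, so no
  mass is counted twice. After a return there is no successor and the mass drops out.\<close>

lemma sum_step:
  "(\<Sum>x\<in>V \<times> insert None (Some ` V). P (h @ [x]) * f (h @ [x])) =
     P h * (case act h of Query q \<Rightarrow> (1 - p) * f (good h q) + p * f (bad h q) | Return _ \<Rightarrow> 0)"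
proof (cases "act h")
  case (Return r)
  thus ?thesis by (auto intro!: sum.neutral)
next
  case (Query q)
  hence q: "q \<in> V" using act_in[of h] by simp
  let ?c = "fst (adv v h q)" and ?e = "snd (adv v h q)"
  have "(\<Sum>x\<in>V \<times> insert None (Some ` V). P (h @ [x]) * f (h @ [x])) =
    (\<Sum>x\<in>{(q, ?c), (q, ?e)}. P (h @ [x]) * f (h @ [x]))"
  proof (rule sum.mono_neutral_right)
    show "{(q, ?c), (q, ?e)} \<subseteq> V \<times> insert None (Some ` V)"
      using q valid_in[OF q] adv_props[OF q] by auto
    show "\<forall>x\<in>V \<times> insert None (Some ` V) - {(q, ?c), (q, ?e)}. P (h @ [x]) * f (h @ [x]) = 0"
      using Query by (auto simp: answer_prob_def split: if_splits)
  qed (simp add: finite_V)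
  also have "\<dots> = P h * ((1 - p) * f (good h q) + p * f (bad h q))"
    using adv_props(4)[OF q, of h] Query
    by (auto simp: answer_prob_def good_def bad_def algebra_simps)
  finally show ?thesis using Query by simp
qed

lemma P_nonneg: "0 \<le> P h"
  unfolding P_def path_prob_def using p
  by (intro prod_nonneg) (auto simp: answer_prob_def)

text \<open>Queries and both possible answers stay inside the graph. Hence integrals over all
  histories become series of finite sums.\<close>

lemma P_eq_0:
  assumes "h \<notin> hist (length h)" shows "P h = 0"
  using assms
proof (induction h rule: rev_induct)
  case Nil
  thus ?case by (simp add: hist_0)
next
  case (snoc x h)
  show ?case
  proof (cases "h \<in> hist (length h)")
    case False
    thus ?thesis using snoc.IH by (cases x) simp
  next
    case True
    hence x: "x \<notin> V \<times> insert None (Some ` V)" using snoc.prems by (auto simp: hist_def)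
    show ?thesis
    proof (cases "act h")
      case (Query q)
      hence q: "q \<in> V" using act_in[of h] by simp
      have "(q, fst (adv v h q)) \<in> V \<times> insert None (Some ` V)"
        "(q, snd (adv v h q)) \<in> V \<times> insert None (Some ` V)"
        using q valid_in[OF q adv_props(2)[OF q]] valid_in[OF q adv_props(3)[OF q]] by blast+
      hence "x \<noteq> (q, fst (adv v h q))" "x \<noteq> (q, snd (adv v h q))" using x by metis+
      thus ?thesis using Query by (cases x) (auto simp: answer_prob_def)
    qed (cases x, simp)
  qed
qed

text \<open>The supermartingale argument: \<open>g\<close> pays for the present cost and for its own
  expectation after the next answer, so costs paid and potential left never exceed the initial
  potential.\<close>

lemma potential_bound:
  assumes query: "\<And>h q. act h = Query q \<Longrightarrow> cost h + ((1 - p) * g (good h q) + p * g (bad h q)) \<le> g h"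
    and return: "\<And>h r. act h = Return r \<Longrightarrow> cost h \<le> g h"
  shows "(\<Sum>n<N. \<Sum>h\<in>hist n. P h * cost h) + (\<Sum>h\<in>hist N. P h * g h) \<le> g []"
proof (induction N)
  case 0
  show ?case by (simp add: hist_0 P_def)
next
  case (Suc N)
  have "(\<Sum>h\<in>hist N. P h * cost h) + (\<Sum>h\<in>hist (Suc N). P h * g h) =
    (\<Sum>h\<in>hist N. P h * (cost h + (case act h of Query q \<Rightarrow> (1 - p) * g (good h q) + p * g (bad h q) | Return _ \<Rightarrow> 0)))"
    by (simp add: sum_hist_Suc sum_step sum.distrib distrib_left)
  also have "\<dots> \<le> (\<Sum>h\<in>hist N. P h * g h)"
    using query return by (intro sum_mono mult_left_mono P_nonneg) (auto split: action.split)
  finally show ?case using Suc by simp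
qed

section \<open>From finite horizons to integrals over all histories\<close>

lemma nn_integral_hist:
  assumes "\<And>h. 0 \<le> f h"
  shows "(\<integral>\<^sup>+h. ennreal (P h * f h) \<partial>count_space UNIV) = (\<Sum>n. ennreal (\<Sum>h\<in>hist n. P h * f h))"
proof -
  have "(\<integral>\<^sup>+h. ennreal (P h * f h) \<partial>count_space UNIV) =
    (\<integral>\<^sup>+h. (\<Sum>n. ennreal (P h * f h) * indicator (hist n) h) \<partial>count_space UNIV)"
  proof (intro nn_integral_cong)
    fix h :: "'a history"
    have eq: "(\<lambda>n. ennreal (P h * f h) * indicator (hist n) h) =
        (\<lambda>n. if n = length h then ennreal (P h * f h) else 0)"
    proof
      fix n
      show "ennreal (P h * f h) * indicator (hist n) h = (if n = length h then ennreal (P h * f h) else 0)"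
      proof (cases "h \<in> hist n")
        case True
        moreover from this have "n = length h" by (simp add: hist_def)
        ultimately show ?thesis by simp
      qed (use P_eq_0[of h] in auto)
    qed
    have "(\<lambda>n. ennreal (P h * f h) * indicator (hist n) h) sums ennreal (P h * f h)"
      unfolding eq by (rule sums_single)
    thus "ennreal (P h * f h) = (\<Sum>n. ennreal (P h * f h) * indicator (hist n) h)"
      by (rule sums_unique)
  qed
  also have "\<dots> = (\<Sum>n. \<integral>\<^sup>+h. ennreal (P h * f h) * indicator (hist n) h \<partial>count_space UNIV)"
    by (intro nn_integral_suminf) auto
  also have "\<dots> = (\<Sum>n. ennreal (\<Sum>h\<in>hist n. P h * f h))"
  proof (intro suminf_cong)
    fix n
    have "(\<integral>\<^sup>+h. ennreal (P h * f h) * indicator (hist n) h \<partial>count_space UNIV) =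
      (\<Sum>h\<in>hist n. ennreal (P h * f h) * indicator (hist n) h)"
      by (intro nn_integral_count_space') (auto simp: finite_hist)
    also have "\<dots> = (\<Sum>h\<in>hist n. ennreal (P h * f h))" by (intro sum.cong) auto
    also have "\<dots> = ennreal (\<Sum>h\<in>hist n. P h * f h)"
      by (intro sum_ennreal) (simp add: P_nonneg assms)
    finally show "(\<integral>\<^sup>+h. ennreal (P h * f h) * indicator (hist n) h \<partial>count_space UNIV) =
      ennreal (\<Sum>h\<in>hist n. P h * f h)" .
  qed
  finally show ?thesis .
qed

lemma expected_cost_le:
  assumes query: "\<And>h q. act h = Query q \<Longrightarrow> cost h + ((1 - p) * g (good h q) + p * g (bad h q)) \<le> g h"
    and return: "\<And>h r. act h = Return r \<Longrightarrow> cost h \<le> g h"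
    and "\<And>h. 0 \<le> cost h" "\<And>h. 0 \<le> g h"
  shows "(\<integral>\<^sup>+h. ennreal (P h * cost h) \<partial>count_space UNIV) \<le> ennreal (g [])"
  unfolding nn_integral_hist[OF assms(3)]
proof (rule suminf_le_const)
  fix N
  have "(\<Sum>n<N. \<Sum>h\<in>hist n. P h * cost h) + 0 \<le> (\<Sum>n<N. \<Sum>h\<in>hist n. P h * cost h) + (\<Sum>h\<in>hist N. P h * g h)"
    by (intro add_left_mono sum_nonneg mult_nonneg_nonneg P_nonneg assms)
  also have "\<dots> \<le> g []" by (rule potential_bound[OF query return])
  finally show "(\<Sum>n<N. ennreal (\<Sum>h\<in>hist n. P h * cost h)) \<le> ennreal (g [])"
    by (subst sum_ennreal) (auto intro!: sum_nonneg ennreal_leI simp: P_nonneg assms)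
qed simp

definition returns :: "'a history \<Rightarrow> real" where
  "returns h = (case act h of Query _ \<Rightarrow> 0 | Return _ \<Rightarrow> 1)"

text \<open>Here \<open>g\<close> bounds the expected number of remaining queries; its finiteness
  also forces almost sure termination.\<close>

lemma expected_length_le:
  assumes "\<And>h q. act h = Query q \<Longrightarrow> 1 + ((1 - p) * g (good h q) + p * g (bad h q)) \<le> g h"
    and "\<And>h. 0 \<le> g h"
  shows "(\<integral>\<^sup>+h. ennreal (P h * (returns h * real (length h))) \<partial>count_space UNIV) \<le> ennreal (g [])"
    and "(\<integral>\<^sup>+h. ennreal (P h * returns h) \<partial>count_space UNIV) = 1"
proof -
  \<comment> \<open>The cost is charged only on return, so the potential stores one unit for each
    query already made.\<close>
  let ?g = "\<lambda>h. real (length h) + g h" and ?cost = "\<lambda>h. returns h * real (length h)"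
  have query: "?cost h + ((1 - p) * ?g (good h q) + p * ?g (bad h q)) \<le> ?g h" if "act h = Query q" for h q
    using assms(1)[OF that] that by (simp add: returns_def good_def bad_def algebra_simps)
  have return: "?cost h \<le> ?g h" if "act h = Return r" for h r
    using that assms(2)[of h] by (simp add: returns_def)
  have rn: "0 \<le> returns h" for h by (simp add: returns_def split: action.split)
  show "(\<integral>\<^sup>+h. ennreal (P h * (returns h * real (length h))) \<partial>count_space UNIV) \<le> ennreal (g [])"
    using expected_cost_le[of ?cost ?g, OF query return] rn assms(2) by simp
  define S where "S n = (\<Sum>h\<in>hist n. P h)" for n
  have S0: "0 \<le> S n" for n by (simp add: S_def sum_nonneg P_nonneg)
  have tele: "(\<Sum>n<N. \<Sum>h\<in>hist n. P h * returns h) = 1 - S N" for N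
  proof (induction N)
    case 0 show ?case by (simp add: S_def hist_0 P_def)
  next
    case (Suc N)
    have "S (Suc N) = (\<Sum>h\<in>hist N. P h * (1 - returns h))"
      unfolding S_def sum_hist_Suc using sum_step[where f = "\<lambda>_. 1"]
      by (intro sum.cong) (auto simp: returns_def split: action.split)
    also have "\<dots> = S N - (\<Sum>h\<in>hist N. P h * returns h)"
      by (simp add: S_def right_diff_distrib sum_subtractf)
    finally show ?case using Suc by simp
  qed
  \<comment> \<open>Markov's inequality: \<open>S N\<close> is the mass of runs with at least
    \<open>N\<close> queries, each of which has stored at least \<open>N\<close>.\<close>
  have bound: "real N * S N \<le> g []" for N
  proof -
    have "real N * S N \<le> (\<Sum>h\<in>hist N. P h * ?g h)"
      unfolding S_def sum_distrib_left
      using P_nonneg assms(2) by (intro sum_mono) (auto simp: hist_def algebra_simps)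
    also have "\<dots> \<le> (\<Sum>n<N. \<Sum>h\<in>hist n. P h * ?cost h) + (\<Sum>h\<in>hist N. P h * ?g h)"
      using P_nonneg rn by (simp add: sum_nonneg)
    also have "\<dots> \<le> ?g []" by (rule potential_bound[OF query return])
    finally show ?thesis by simp
  qed
  have "S \<longlonglongrightarrow> 0"
  proof (rule tendsto_sandwich)
    show "\<forall>\<^sub>F n in sequentially. 0 \<le> S n" by (simp add: S0)
    show "\<forall>\<^sub>F n in sequentially. S n \<le> g [] / real n"
      using eventually_gt_at_top[of 0] by eventually_elim (use bound in \<open>simp add: field_simps\<close>)
    show "(\<lambda>n. g [] / real n) \<longlonglongrightarrow> 0" by (rule lim_const_over_n)
  qed simp
  hence "(\<lambda>N. 1 - S N) \<longlonglongrightarrow> 1 - 0" by (intro tendsto_intros)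
  hence "(\<lambda>n. \<Sum>h\<in>hist n. P h * returns h) sums 1" by (simp add: sums_def tele)
  hence "(\<Sum>n. ennreal (\<Sum>h\<in>hist n. P h * returns h)) = ennreal 1"
    by (intro suminf_ennreal_eq) (auto intro!: sum_nonneg mult_nonneg_nonneg P_nonneg rn)
  thus "(\<integral>\<^sup>+h. ennreal (P h * returns h) \<partial>count_space UNIV) = 1"
    using nn_integral_hist[OF rn] by simp
qed

abbreviation "term_P \<equiv> term_prob (\<lambda>h. return_pmf (act h)) adv p v"

lemma nn_integral_term:
  "(\<integral>\<^sup>+hr. ennreal (term_P (fst hr) (snd hr)) * f (fst hr) \<partial>count_space UNIV) =
     (\<integral>\<^sup>+h. ennreal (P h * returns h) * f h \<partial>count_space UNIV)"
proof -
  have "(\<integral>\<^sup>+hr. ennreal (term_P (fst hr) (snd hr)) * f (fst hr) \<partial>count_space UNIV) =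
    (\<integral>\<^sup>+h. \<integral>\<^sup>+r. ennreal (term_P h r) * f h \<partial>count_space UNIV \<partial>count_space UNIV)"
    using nn_integral_fst_count_space[of "\<lambda>hr. ennreal (term_P (fst hr) (snd hr)) * f (fst hr)"] by simp
  also have "\<dots> = (\<integral>\<^sup>+h. ennreal (P h * returns h) * f h \<partial>count_space UNIV)"
  proof (intro nn_integral_cong)
    fix h :: "'a history"
    show "(\<integral>\<^sup>+r. ennreal (term_P h r) * f h \<partial>count_space UNIV) = ennreal (P h * returns h) * f h"
    proof (cases "act h")
      case (Query q)
      thus ?thesis by (simp add: term_prob_def returns_def)
    next
      case (Return r0)
      have "(\<integral>\<^sup>+r. ennreal (term_P h r) * f h \<partial>count_space UNIV) = (\<Sum>r\<in>{r0}. ennreal (term_P h r) * f h)"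
        by (intro nn_integral_count_space') (auto simp: term_prob_def Return)
      thus ?thesis by (simp add: term_prob_def returns_def Return P_def)
    qed
  qed
  finally show ?thesis .
qed

text \<open>With the indicator of a wrong return as cost, \<open>expected_cost_le\<close> bounds the
  error by \<open>g []\<close>; as the run returns almost surely, all remaining mass is
  success.\<close>

lemma success_ge:
  assumes "\<And>h q. act h = Query q \<Longrightarrow> (1 - p) * g (good h q) + p * g (bad h q) \<le> g h"
    and "\<And>h r. act h = Return r \<Longrightarrow> r \<noteq> v \<Longrightarrow> 1 \<le> g h"
    and "\<And>h. 0 \<le> g h"
    and total: "(\<integral>\<^sup>+h. ennreal (P h * returns h) \<partial>count_space UNIV) = 1"
  shows "ennreal (1 - g []) \<le> (\<integral>\<^sup>+h. ennreal (term_P h v) \<partial>count_space UNIV)"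
proof -
  define wrong :: "'a history \<Rightarrow> real"
    where "wrong h = (case act h of Query _ \<Rightarrow> 0 | Return r \<Rightarrow> if r = v then 0 else 1)" for h
  have wrong: "(\<integral>\<^sup>+h. ennreal (P h * wrong h) \<partial>count_space UNIV) \<le> ennreal (g [])"
    using assms by (intro expected_cost_le) (auto simp: wrong_def split: action.splits)
  have "ennreal (P h * returns h) = ennreal (term_P h v) + ennreal (P h * wrong h)" for h
    using P_nonneg[of h]
    by (auto simp: returns_def wrong_def term_prob_def P_def split: action.split)
  hence "1 = (\<integral>\<^sup>+h. ennreal (term_P h v) \<partial>count_space UNIV) + (\<integral>\<^sup>+h. ennreal (P h * wrong h) \<partial>count_space UNIV)"
    using total by (simp add: nn_integral_add)
  also have "\<dots> \<le> (\<integral>\<^sup>+h. ennreal (term_P h v) \<partial>count_space UNIV) + ennreal (g [])"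
    using wrong by (rule add_left_mono)
  finally have "1 - ennreal (g []) \<le> (\<integral>\<^sup>+h. ennreal (term_P h v) \<partial>count_space UNIV)"
    by (simp add: ennreal_minus_le_iff add.commute)
  thus ?thesis using assms(3)[of "[]"] by (simp add: ennreal_minus flip: ennreal_1)
qed

end

section \<open>Search by weights and tests\<close>

type_synonym 'a search_state = "('a \<Rightarrow> real) \<times> nat \<times> nat"

locale noisy_search =
  fixes V :: "'a set" and E :: "('a \<times> 'a) set" and p \<delta> :: real
  assumes conn: "connected_graph V E"
    and p: "0 < p" "p < 1/2"
    and \<delta>: "0 < \<delta>" "\<delta> < 1/2"
begin

definition L :: real where "L = (1 - p) / p"

definition budget :: "nat \<Rightarrow> real" where
  "budget k = log 2 (1 / \<delta>) + 1 + real k * refund p"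

text \<open>On the true target each unit of surplus takes \<open>1 / (1 - 2 * p)\<close> queries in
  expectation, worth \<open>yield p\<close>; this is the largest lead that the budget can pay
  for.\<close>

definition threshold :: "nat \<Rightarrow> nat" where
  "threshold k = nat \<lfloor>budget k / yield p\<rfloor>"

text \<open>\<open>tail k\<close> is the error allowed to all tests after the \<open>k\<close>-th rejection.\<close>

definition tail :: "nat \<Rightarrow> real" where
  "tail k = \<delta> * L powr (- real k * refund p / yield p)"

definition heavy :: "('a \<Rightarrow> real) \<Rightarrow> 'a \<Rightarrow> bool" where
  "heavy w r \<longleftrightarrow> r \<in> V \<and> sum w V \<le> 2 * w r"

definition has_heavy :: "('a \<Rightarrow> real) \<Rightarrow> bool" where
  "has_heavy w \<longleftrightarrow> (\<exists>r. heavy w r)"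

text \<open>Two vertices may be heavy at once. The choice depends on the weights only, which a
  running test leaves unchanged, so the candidate is the same throughout the test.\<close>

definition candidate :: "('a \<Rightarrow> real) \<Rightarrow> 'a" where
  "candidate w = (SOME r. heavy w r)"

text \<open>A lead of one no has the net Bayesian effect of a single no on the candidate: it loses a
  factor \<open>L\<close> against all other vertices.\<close>

definition demote :: "('a \<Rightarrow> real) \<Rightarrow> 'a \<Rightarrow> 'a \<Rightarrow> real" where
  "demote w r = w(r := w r / L)"

definition reweigh :: "('a \<Rightarrow> real) \<Rightarrow> 'a \<Rightarrow> 'a answer \<Rightarrow> 'a \<Rightarrow> real" where
  "reweigh w q a = (\<lambda>v. (if correct_answer E v q a then 1 - p else p) * w v)"

text \<open>A state \<open>(w, k, j)\<close> holds the current weights, the number of rejected candidates, and the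
  surplus of yes answers in the running test of the candidate (if there is a heavy vertex).\<close>

fun update :: "'a search_state \<Rightarrow> 'a \<times> 'a answer \<Rightarrow> 'a search_state" where
  "update (w, k, j) (q, a) =
     (if has_heavy w then
        if a = None then (w, k, Suc j)
        else if j = 0 then (demote w (candidate w), Suc k, 0)
        else (w, k, j - 1)
      else (reweigh w q a, k, 0))"

fun choose_action :: "'a search_state \<Rightarrow> 'a action" where
  "choose_action (w, k, j) =
     (if has_heavy w then
        if threshold k \<le> j then Return (candidate w) else Query (candidate w)
      else Query (median V E w))"

definition positive :: "'a \<Rightarrow> ('a \<Rightarrow> real) \<Rightarrow> bool" where
  "positive v w \<longleftrightarrow> (\<forall>u. 0 \<le> w u) \<and> 0 < w v"

text \<open>For the initial weights this is the self-information of \<open>v\<close>, whose mean is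
  the entropy.\<close>

definition info :: "('a \<Rightarrow> real) \<Rightarrow> 'a \<Rightarrow> real" where
  "info w v = log 2 (sum w V / w v)"

text \<open>The time potential counts queries in units of \<open>1 / info_cap p\<close>. While the target itself is being
  tested, it uses that \<open>(1 / L) ^ Suc j\<close> is harmonic for the surplus \<open>j\<close> and equals 1 at the rejection
  \<open>j = -1\<close>. The subtraction \<open>threshold k - j\<close> is truncated only where the algorithm has stopped.\<close>

fun time_potential :: "'a \<Rightarrow> 'a search_state \<Rightarrow> real" where
  "time_potential v (w, k, j) =
     (if has_heavy w then
        let rest = info (demote w (candidate w)) v + budget (Suc k)
        in if candidate w = v
           then yield p * real (threshold k - j)
                + (1 / L) ^ Suc j * max 0 (rest - yield p * (real (threshold k) + 1))
           else yield p * (real j + 1) + rest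
      else info w v + budget k)"

text \<open>For a wrong candidate the quotient is the gambler's ruin probability of reaching the
  threshold before a rejection.\<close>

fun error_potential :: "'a \<Rightarrow> 'a search_state \<Rightarrow> real" where
  "error_potential v (w, k, j) =
     (if has_heavy w then
        tail (Suc k) + (if candidate w = v then 0 else (L ^ Suc j - 1) / (L ^ Suc (threshold k) - 1))
      else tail k)"

section \<open>Elementary facts on weights, budgets and thresholds\<close>

lemma finite_V: "finite V" using conn by (simp add: connected_graph_def ugraph_def)

lemma L_gt_1: "1 < L" using p by (simp add: L_def field_simps)

text \<open>Powers of \<open>1 / L\<close> are harmonic for the walk that rises with probability
  \<open>1 - p\<close> (target tested), powers of \<open>L\<close> for the one that rises with
  probability \<open>p\<close> (wrong candidate).\<close>

lemma L_harmonic: "(1 - p) * (1 / L) + p * L = 1" "(1 - p) + p * L\<^sup>2 = L"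
  using p by (auto simp: L_def field_simps power2_eq_square)

lemma candidate_heavy: "has_heavy w \<Longrightarrow> heavy w (candidate w)"
  unfolding candidate_def has_heavy_def by (rule someI_ex)

lemma candidate_in: "has_heavy w \<Longrightarrow> candidate w \<in> V"
  using candidate_heavy by (auto simp: heavy_def)

lemma action_in: "case choose_action st of Query q \<Rightarrow> q \<in> V | Return r \<Rightarrow> r \<in> V"
  using candidate_in median_props(1)[OF conn] by (cases st) auto

lemma budget_ge: "2 \<le> budget k"
proof -
  have "log 2 2 \<le> log 2 (1 / \<delta>)" using \<delta> by (subst log_le_cancel_iff) (auto simp: field_simps)
  moreover have "0 \<le> real k * refund p" using refund_pos[OF p] by simp
  ultimately show ?thesis by (simp add: budget_def)
qed

lemma budget_Suc: "budget (Suc k) = budget k + refund p"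
  by (simp add: budget_def algebra_simps)

lemma threshold_bounds:
  "yield p * real (threshold k) \<le> budget k" "budget k < yield p * (real (threshold k) + 1)"
proof -
  have y: "0 < yield p" by (rule yield_pos[OF p])
  hence "0 \<le> \<lfloor>budget k / yield p\<rfloor>" using budget_ge[of k] by simp
  hence "real (threshold k) = of_int \<lfloor>budget k / yield p\<rfloor>" by (simp add: threshold_def)
  hence "real (threshold k) \<le> budget k / yield p" "budget k / yield p < real (threshold k) + 1"
    by linarith+
  thus "yield p * real (threshold k) \<le> budget k" "budget k < yield p * (real (threshold k) + 1)"
    using y by (auto simp: field_simps)
qed

lemma positive_demote: "positive v w \<Longrightarrow> positive v (demote w r)"
  using L_gt_1 by (auto simp: positive_def demote_def)

lemma positive_reweigh: "positive v w \<Longrightarrow> positive v (reweigh w q a)"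
  using p by (auto simp: positive_def reweigh_def)

lemma positive_update: "positive v (fst st) \<Longrightarrow> positive v (fst (update st x))"
  using positive_demote positive_reweigh by (cases st; cases x) auto

lemma weight_le_sum: "positive v w \<Longrightarrow> u \<in> V \<Longrightarrow> w u \<le> sum w V"
  using finite_V by (intro member_le_sum) (auto simp: positive_def)

lemma info_nonneg: "positive v w \<Longrightarrow> v \<in> V \<Longrightarrow> 0 \<le> info w v"
  using weight_le_sum[of v w v] by (simp add: info_def positive_def)

section \<open>The time potential\<close>

lemma time_potential_nonneg:
  assumes "positive v (fst st)" "v \<in> V" shows "0 \<le> time_potential v st"
proof -
  obtain w k j where st: "st = (w, k, j)" by (cases st)
  note [simp] = yield_pos[OF p, THEN less_imp_le] L_gt_1[THEN less_trans[OF zero_less_one], THEN less_imp_le]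
  have "0 \<le> info w v + budget k" "0 \<le> info (demote w (candidate w)) v + budget (Suc k)"
    using assms info_nonneg positive_demote budget_ge[of k] budget_ge[of "Suc k"]
    by (fastforce simp: st intro: add_nonneg_nonneg)+
  thus ?thesis by (auto simp: st Let_def)
qed

lemma sum_demote: "r \<in> V \<Longrightarrow> sum (demote w r) V = sum w V - w r + w r / L"
  using finite_V by (simp add: demote_def sum.remove[of V r])

text \<open>Opening a test is free: whether or not the new weights have a heavy vertex, a change of
  weights can be judged by \<open>info\<close> and \<open>budget\<close> alone.\<close>

lemma time_potential_start:
  assumes w: "positive v w" and v: "v \<in> V"
  shows "time_potential v (w, k, 0) \<le> info w v + budget k"
proof (cases "has_heavy w")
  case False
  thus ?thesis by simp
next
  case True
  define r where "r = candidate w"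
  have r: "r \<in> V" "sum w V \<le> 2 * w r" using candidate_heavy[OF True] by (auto simp: r_def heavy_def)
  define w' where "w' = demote w r"
  have w': "positive v w'" using w by (simp add: w'_def positive_demote)
  have sum': "sum w' V = sum w V - w r + w r / L" using sum_demote[OF r(1)] by (simp add: w'_def)
  have wv: "0 < w v" "0 < w' v" using w w' by (auto simp: positive_def)
  have S: "0 < sum w V" "0 < sum w' V"
    using wv weight_le_sum[OF w v] weight_le_sum[OF w' v] by linarith+
  show ?thesis
  proof (cases "r = v")
    case False
    \<comment> \<open>At least half of the weight is multiplied by \<open>p / (1 - p)\<close>, which
      leaves at most \<open>1 / (2 * (1 - p))\<close> of the total. By
      \<open>yield_plus_refund_le\<close> this pays for the test and for the increase of the
      budget.\<close>
    have "2 * (1 - p) * sum w' V \<le> sum w V"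
    proof -
      have "(1 - p) * (w r / L) = p * w r" using p by (simp add: L_def)
      hence "2 * (1 - p) * (w r / L) = 2 * p * w r" by (simp only: mult.assoc)
      hence "2 * (1 - p) * sum w' V = 2 * (1 - p) * sum w V - (1 - 2 * p) * (2 * w r)"
        unfolding sum' by (simp add: algebra_simps)
      also have "\<dots> \<le> 2 * (1 - p) * sum w V - (1 - 2 * p) * sum w V"
        using r(2) p by (intro diff_left_mono mult_left_mono) auto
      finally show ?thesis by (simp add: algebra_simps)
    qed
    moreover have "w' v = w v" using False by (simp add: w'_def demote_def)
    ultimately have "2 * (1 - p) * (sum w' V / w' v) \<le> sum w V / w v"
      using wv by (simp add: divide_right_mono)
    hence "log 2 (2 * (1 - p) * (sum w' V / w' v)) \<le> log 2 (sum w V / w v)"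
      using S wv p by (subst log_le_cancel_iff) auto
    also have "log 2 (2 * (1 - p) * (sum w' V / w' v)) = log 2 (2 * (1 - p)) + info w' v"
      unfolding info_def using S wv p by (subst log_mult) auto
    finally have "log 2 (2 * (1 - p)) + info w' v \<le> info w v" by (simp add: info_def)
    thus ?thesis using True False yield_plus_refund_le[OF p]
      by (simp add: budget_Suc Let_def flip: r_def w'_def)
  next
    case True': True
    \<comment> \<open>\<open>z\<close> are the odds against the target. A mistaken rejection raises
      \<open>info\<close> at most \<open>L\<close>-fold, which the factor \<open>1 / L\<close> in
      the potential cancels.\<close>
    define z where "z = (sum w V - w v) / w v"
    have z: "0 \<le> z" using wv weight_le_sum[OF w v] by (simp add: z_def)
    have "sum w V / w v = 1 + z" using wv by (simp add: z_def field_simps)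
    hence iw: "info w v = log 2 (1 + z)" by (simp add: info_def)
    have "w' v = w v / L" using True' by (simp add: w'_def demote_def)
    hence "sum w' V / w' v = 1 + L * z"
      using wv L_gt_1 True' by (simp add: sum' z_def field_simps)
    hence iw': "info w' v = log 2 (1 + L * z)" by (simp add: info_def)
    have "log 2 (1 + L * z) \<le> L * log 2 (1 + z)" using z L_gt_1 by (intro log_one_plus_scaled_le) auto
    hence X: "info w' v / L \<le> info w v" using L_gt_1 by (simp add: iw iw' field_simps)
    define t where "t = yield p * real (threshold k)"
    have t: "t \<le> budget k" using threshold_bounds(1) by (simp add: t_def)
    let ?Z = "info w' v + budget (Suc k) - yield p * (real (threshold k) + 1)"
    have "t + (1 / L) * max 0 ?Z \<le> info w v + budget k"
    proof (cases "?Z \<le> 0")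
      case True
      thus ?thesis using t info_nonneg[OF w v] by simp
    next
      case False
      \<comment> \<open>The refund in \<open>budget (Suc k)\<close> is at most the additional
        \<open>yield p\<close> subtracted in \<open>?Z\<close>.\<close>
      have "(1 / L) * ?Z \<le> (1 / L) * (info w' v + (budget k - t))"
        using refund_le_yield[OF p] L_gt_1
        by (intro mult_left_mono) (auto simp: budget_Suc t_def algebra_simps)
      also have "\<dots> = info w' v / L + (budget k - t) / L" by (simp add: add_divide_distrib)
      also have "\<dots> \<le> info w v + (budget k - t)"
        using X t L_gt_1 by (intro add_mono) (auto simp: divide_le_eq intro: mult_left_mono[of 1 L "budget k - t", simplified])
      finally show ?thesis using False by simp
    qed
    moreover have "candidate w = v" "demote w v = w'" using True' by (simp_all add: r_def w'_def)
    ultimately show ?thesis using True by (simp add: Let_def t_def)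
  qed
qed

text \<open>At most half of the weight is consistent with the answer, so the total falls to at most
  \<open>p + (1 - 2 * p) / 2 = 1 / 2\<close> of its value. This holds for every valid answer; only
  the target's own factor depends on the noise.\<close>

lemma info_reweigh:
  assumes w: "positive v w" and v: "v \<in> V" and light: "\<not> has_heavy w"
    and a: "valid_answer E (median V E w) a"
  shows "info (reweigh w (median V E w) a) v
    \<le> info w v - 1 - log 2 (if correct_answer E v (median V E w) a then 1 - p else p)"
proof -
  let ?q = "median V E w" and ?w = "reweigh w (median V E w) a"
  define C where "C = {u \<in> V. correct_answer E u ?q a}"
  have "2 * sum w C \<le> sum w V" unfolding C_def
    using light w by (intro consistent_le_half[OF conn _ _ a]) (force simp: heavy_def has_heavy_def positive_def)+
  hence "(1 - 2 * p) * (2 * sum w C) \<le> (1 - 2 * p) * sum w V" using p by (intro mult_left_mono) auto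
  moreover have "sum ?w V = p * sum w V + (1 - 2 * p) * sum w C"
  proof -
    have "sum ?w V = (\<Sum>u\<in>V. p * w u + (if u \<in> C then (1 - 2 * p) * w u else 0))"
      by (intro sum.cong) (auto simp: reweigh_def C_def algebra_simps)
    also have "\<dots> = p * sum w V + (\<Sum>u\<in>V. if u \<in> C then (1 - 2 * p) * w u else 0)"
      by (simp add: sum.distrib sum_distrib_left)
    also have "(\<Sum>u\<in>V. if u \<in> C then (1 - 2 * p) * w u else 0) = (\<Sum>u\<in>C. (1 - 2 * p) * w u)"
      using finite_V by (intro sum.mono_neutral_cong_right) (auto simp: C_def)
    finally show ?thesis by (simp add: sum_distrib_left)
  qed
  ultimately have half: "sum ?w V \<le> sum w V / 2" by (simp add: algebra_simps)
  define f where "f = (if correct_answer E v ?q a then 1 - p else p)"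
  have f: "0 < f" "?w v = f * w v" using p by (auto simp: f_def reweigh_def)
  have wv: "0 < w v" "0 < ?w v" using w positive_reweigh[OF w] by (auto simp: positive_def)
  have S: "0 < sum w V" "0 < sum ?w V"
    using wv weight_le_sum[OF w v] weight_le_sum[OF positive_reweigh[OF w] v] by (fastforce intro: less_le_trans)+
  have "sum ?w V / ?w v \<le> sum w V / 2 / (f * w v)"
    unfolding f(2) using half f(1) wv(1) by (intro divide_right_mono) auto
  hence "info ?w v \<le> log 2 (sum w V / 2 / (f * w v))"
    unfolding info_def using S wv f by (subst log_le_cancel_iff) auto
  also have "\<dots> = info w v - 1 - log 2 f"
    unfolding info_def using S wv f by (simp add: log_divide log_mult)
  finally show ?thesis by (simp add: f_def)
qed

text \<open>A median query gains \<open>info_cap p\<close> by averaging \<open>info_reweigh\<close>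
  over the noise. On a wrong candidate the surplus falls by at least \<open>1 - 2 * p\<close> on
  average; on the target it rises by that much, and the second summand is harmonic.\<close>

lemma time_potential_step:
  assumes w: "positive v (fst st)" and v: "v \<in> V"
    and q: "choose_action st = Query q"
    and c: "correct_answer E v q c" and e: "valid_answer E q e" "e \<noteq> c"
  shows "info_cap p + ((1 - p) * time_potential v (update st (q, c)) + p * time_potential v (update st (q, e)))
    \<le> time_potential v st"
proof -
  obtain w k j where st: "st = (w, k, j)" by (cases st)
  have w: "positive v w" using w st by simp
  have y: "(1 - 2 * p) * yield p = info_cap p" using p by (simp add: yield_def)
  show ?thesis
  proof (cases "has_heavy w")
    case False
    hence qm: "q = median V E w" using q st by simp
    have cv: "valid_answer E q c" using c by (auto simp: correct_answer_def valid_answer_def)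
    note light = info_reweigh[OF w v False, folded qm]
    note start = time_potential_start[OF positive_reweigh[OF w] v]
    have C: "time_potential v (update st (q, c)) \<le> info w v - 1 - log 2 (1 - p) + budget k"
      using start[of q c k] light[OF cv] c False by (simp add: st del: time_potential.simps)
    \<comment> \<open>An erroneous answer may still lie on a shortest path to the target; its factor
      is then \<open>1 - p\<close>, which is no worse.\<close>
    have "log 2 p \<le> log 2 (if correct_answer E v q e then 1 - p else p)"
      using p by (subst log_le_cancel_iff) auto
    hence X: "time_potential v (update st (q, e)) \<le> info w v - 1 - log 2 p + budget k"
      using start[of q e k] light[OF e(1)] False by (simp add: st del: time_potential.simps)
    have "(1 - p) * time_potential v (update st (q, c)) + p * time_potential v (update st (q, e))
      \<le> (1 - p) * (info w v - 1 - log 2 (1 - p) + budget k) + p * (info w v - 1 - log 2 p + budget k)"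
      using C X p by (intro add_mono mult_left_mono) auto
    also have "\<dots> = info w v + budget k - info_cap p"
      by (simp add: info_cap_def bin_entropy_def algebra_simps)
    finally show ?thesis using False by (simp add: st)
  next
    case True
    hence qc: "q = candidate w" and j: "j < threshold k" using q st by (auto split: if_splits)
    have qV: "q \<in> V" using candidate_in[OF True] qc by simp
    define w' where "w' = demote w q"
    define rest where "rest = info w' v + budget (Suc k)"
    have reject: "time_potential v (w', Suc k, 0) \<le> rest"
      unfolding rest_def using time_potential_start[OF _ v, of w'] w by (simp add: w'_def positive_demote)
    show ?thesis
    proof (cases "q = v")
      case False
      let ?f = "\<lambda>i::real. yield p * (i + 1) + rest"
      have f: "time_potential v (w, k, i) = ?f (real i)" for i
        using True False by (simp add: rest_def w'_def qc)
      \<comment> \<open>At \<open>j = 0\<close> a no rejects the candidate, and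
        \<open>?f (- 1) = rest\<close> bounds the potential after that.\<close>
      have no: "time_potential v (update st (q, a)) \<le> ?f (real j - 1)" if "a \<noteq> None" for a
        using that True reject f[of "j - 1"]
        by (cases j) (auto simp: st simp del: time_potential.simps simp flip: qc w'_def)
      have cN: "c \<noteq> None" using c False by (auto simp: correct_answer_def)
      \<comment> \<open>The error may again be a no, which only lowers the potential.\<close>
      have "time_potential v (update st (q, e)) \<le> ?f (real j + 1)"
      proof (cases "e = None")
        case True': True
        have "update st (q, e) = (w, k, Suc j)" using True True' by (simp add: st)
        thus ?thesis using f[of "Suc j"] by (simp add: add.commute)
      next
        case False
        have "?f (real j - 1) \<le> ?f (real j + 1)" using yield_pos[OF p] by simp
        thus ?thesis using no[OF False] by linarith
      qed
      hence "(1 - p) * time_potential v (update st (q, c)) + p * time_potential v (update st (q, e))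
        \<le> (1 - p) * ?f (real j - 1) + p * ?f (real j + 1)"
        using no[OF cN] p by (intro add_mono mult_left_mono) auto
      also have "\<dots> = ?f (real j) - (1 - 2 * p) * yield p" by (simp add: algebra_simps)
      finally show ?thesis unfolding st f y by simp
    next
      case True': True
      define Z where "Z = max 0 (rest - yield p * (real (threshold k) + 1))"
      let ?g = "\<lambda>i. yield p * real (threshold k - i) + (1 / L) ^ Suc i * Z"
      have g: "time_potential v (w, k, i) = ?g i" for i
        using True True' by (simp add: rest_def w'_def qc Z_def Let_def)
      have "c = None" "e \<noteq> None" using c e True' by (auto simp: correct_answer_def)
      hence yes: "time_potential v (update st (q, c))
          \<le> yield p * (real (threshold k) - real j - 1) + (1 / L) ^ Suc (Suc j) * Z"
        using True g[of "Suc j"] j by (simp add: st of_nat_diff diff_diff_eq add.commute del: time_potential.simps)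
      have no: "time_potential v (update st (q, e)) \<le> yield p * (real (threshold k) - real j + 1) + (1 / L) ^ j * Z"
      proof (cases j)
        case 0
        \<comment> \<open>A rejection is surplus -1, where the harmonic factor is 1;
          \<open>Z\<close> is chosen so that the formula at -1 covers \<open>rest\<close>.\<close>
        have "rest \<le> yield p * (real (threshold k) + 1) + Z" by (simp add: Z_def)
        moreover have "update st (q, e) = (w', Suc k, 0)"
          using 0 True \<open>e \<noteq> None\<close> by (simp add: st qc w'_def)
        ultimately show ?thesis using reject 0 by (simp del: time_potential.simps)
      next
        case (Suc i)
        have "update st (q, e) = (w, k, i)" using True \<open>e \<noteq> None\<close> Suc by (simp add: st)
        thus ?thesis using g[of i] Suc j by (simp add: of_nat_diff algebra_simps)
      qed
      have "(1 - p) * time_potential v (update st (q, c)) + p * time_potential v (update st (q, e))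
        \<le> (1 - p) * (yield p * (real (threshold k) - real j - 1) + (1 / L) ^ Suc (Suc j) * Z)
          + p * (yield p * (real (threshold k) - real j + 1) + (1 / L) ^ j * Z)"
        using p by (intro add_mono mult_left_mono[OF yes] mult_left_mono[OF no]) auto
      also have "\<dots> = yield p * (real (threshold k) - real j) - (1 - 2 * p) * yield p
          + ((1 - p) * (1 / L) + p * L) * ((1 / L) ^ Suc j * Z)"
      proof -
        have "(1 / L) ^ Suc (Suc j) * Z = (1 / L) * ((1 / L) ^ Suc j * Z)"
          "(1 / L) ^ j * Z = L * ((1 / L) ^ Suc j * Z)" using L_gt_1 by simp_all
        thus ?thesis by (simp only:) (simp add: algebra_simps del: power_Suc)
      qed
      also have "\<dots> = ?g j - info_cap p"
        unfolding L_harmonic y using j by (simp add: of_nat_diff)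
      finally show ?thesis unfolding st g by simp
    qed
  qed
qed

section \<open>The error potential\<close>

lemma tail_step: "(L - 1) / (L ^ Suc (threshold k) - 1) \<le> tail k - tail (Suc k)"
proof -
  \<comment> \<open>\<open>A * Q\<close> is the power of \<open>L\<close> that
    \<open>budget k\<close> affords, \<open>B\<close> the ratio of successive tails, and
    \<open>tail k = \<delta> / Q\<close>; the claim is \<open>odds_tail_bound\<close> scaled by
    \<open>Q\<close>.\<close>
  define A where "A = L powr ((log 2 (1 / \<delta>) + 1) / yield p)"
  define B where "B = L powr (- refund p / yield p)"
  define Q where "Q = L powr (real k * refund p / yield p)"
  have y: "0 < yield p" by (rule yield_pos[OF p])
  have Q: "1 \<le> Q" unfolding Q_def using L_gt_1 y refund_pos[OF p] by (intro ge_one_powr_ge_zero) auto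
  have B: "B \<le> 1" unfolding B_def using L_gt_1 y refund_pos[OF p] powr_mono[of "- refund p / yield p" 0 L] by simp
  have A: "1 < A" unfolding A_def using L_gt_1 y budget_ge[of 0] by (intro gr_one_powr) (auto simp: budget_def)
  have "A * Q = L powr (budget k / yield p)"
    by (simp add: A_def Q_def budget_def add_divide_distrib flip: powr_add)
  \<comment> \<open>Rounding the threshold down does no harm, because the ruin probability involves
    \<open>Suc (threshold k)\<close>.\<close>
  also have "\<dots> \<le> L powr real (Suc (threshold k))"
    using L_gt_1 y threshold_bounds(2)[of k] by (intro powr_mono) (auto simp: divide_le_eq algebra_simps)
  also have "\<dots> = L ^ Suc (threshold k)" using L_gt_1 by (subst powr_realpow) auto
  finally have X: "A * Q \<le> L ^ Suc (threshold k)" .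
  have "1 * 1 < A * Q" using A Q by (intro mult_less_le_imp_less) auto
  hence AQ: "1 < L ^ Suc (threshold k)" using X by linarith
  have "- real k * refund p / yield p = - (real k * refund p / yield p)" by simp
  hence t: "tail k = \<delta> / Q" unfolding tail_def Q_def by (simp add: powr_minus_divide)
  have "- real (Suc k) * refund p / yield p = - refund p / yield p - real k * refund p / yield p"
    by (simp add: algebra_simps add_divide_distrib diff_divide_distrib)
  hence t': "tail (Suc k) = \<delta> * B / Q" unfolding tail_def Q_def B_def by (simp only: powr_diff times_divide_eq_right)
  have "(L - 1) * Q \<le> \<delta> * (A - 1) * (1 - B) * Q"
    using odds_tail_bound[OF p \<delta>] Q by (intro mult_right_mono) (auto simp: A_def B_def L_def)
  also have "\<dots> = \<delta> * (1 - B) * (A * Q - Q)" by (simp add: algebra_simps)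
  also have "\<dots> \<le> \<delta> * (1 - B) * (L ^ Suc (threshold k) - 1)"
    using X Q B \<delta> by (intro mult_left_mono) auto
  finally have "(L - 1) / (L ^ Suc (threshold k) - 1) \<le> \<delta> * (1 - B) / Q"
    using AQ Q by (simp add: field_simps)
  thus ?thesis by (simp add: t t' algebra_simps diff_divide_distrib)
qed

lemma error_ratio_nonneg: "0 \<le> (L ^ Suc j - 1) / (L ^ Suc i - 1)"
  using L_gt_1 by (intro divide_nonneg_nonneg) (auto simp del: power_Suc intro: one_le_power)

lemma tail_nonneg: "0 \<le> tail k" using \<delta> by (simp add: tail_def)

lemma tail_mono: "tail (Suc k) \<le> tail k"
  using tail_step[of k] error_ratio_nonneg[of 0 "threshold k"] by simp

lemma error_potential_nonneg: "0 \<le> error_potential v st"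
  using tail_nonneg error_ratio_nonneg by (cases st) (auto simp del: power_Suc intro!: add_nonneg_nonneg)

lemma error_potential_start: "error_potential v (w, k, 0) \<le> tail k"
  using tail_step[of k] tail_mono[of k] by auto

lemma error_potential_return:
  assumes "choose_action st = Return r" "r \<noteq> v"
  shows "1 \<le> error_potential v st"
proof -
  obtain w k j where st: "st = (w, k, j)" by (cases st)
  from assms have h: "has_heavy w" "candidate w \<noteq> v" "threshold k \<le> j"
    by (auto simp: st split: if_splits)
  have "1 < L ^ Suc (threshold k)" using L_gt_1 by (rule one_less_power) simp
  moreover have "L ^ Suc (threshold k) \<le> L ^ Suc j" using h L_gt_1 by (intro power_increasing) auto
  ultimately have "1 \<le> (L ^ Suc j - 1) / (L ^ Suc (threshold k) - 1)" by (simp del: power_Suc)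
  thus ?thesis using h tail_nonneg[of "Suc k"] by (simp add: st del: power_Suc)
qed

text \<open>On a wrong candidate the quotient is harmonic if every error is a yes; an erroneous no
  only lowers it. While the target is tested, no wrong return can happen before another
  rejection.\<close>

lemma error_potential_step:
  assumes q: "choose_action st = Query q"
    and c: "correct_answer E v q c" and e: "e \<noteq> c"
  shows "(1 - p) * error_potential v (update st (q, c)) + p * error_potential v (update st (q, e))
    \<le> error_potential v st"
proof -
  obtain w k j where st: "st = (w, k, j)" by (cases st)
  have avg: "(1 - p) * x + p * y \<le> b" if "x \<le> b" "y \<le> b" for x y b :: real
    using convex_bound_le[OF that, of "1 - p" p] p by simp
  show ?thesis
  proof (cases "has_heavy w")
    case False
    thus ?thesis using error_potential_start
      by (intro avg) (simp_all add: st del: error_potential.simps, simp_all)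
  next
    case True
    hence qc: "q = candidate w" and j: "j < threshold k" using q st by (auto split: if_splits)
    show ?thesis
    proof (cases "q = v")
      case True': True
      have "error_potential v (update st (q, a)) \<le> tail (Suc k)" for a
        using True True' qc error_potential_start[of v "demote w (candidate w)" "Suc k"]
        by (simp add: st del: error_potential.simps) (simp)
      thus ?thesis using True True' qc by (intro avg) (simp_all add: st)
    next
      case False
      let ?d = "L ^ Suc (threshold k) - 1"
      let ?u = "\<lambda>x. tail (Suc k) + (x - 1) / ?d"
      have d: "0 < ?d" using L_gt_1 one_less_power[of L "Suc (threshold k)"] by simp
      have u: "error_potential v (w, k, i) = ?u (L ^ Suc i)" for i
        using True False qc by simp
      have no: "error_potential v (update st (q, a)) \<le> ?u (L ^ j)" if "a \<noteq> None" for a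
      proof (cases j)
        \<comment> \<open>Rejection is surplus -1, where the ruin quotient vanishes because
          \<open>L ^ 0 = 1\<close>.\<close>
        case 0
        hence "update st (q, a) = (demote w (candidate w), Suc k, 0)" using True that by (simp add: st)
        thus ?thesis using 0 error_potential_start[of v "demote w (candidate w)" "Suc k"]
          by (simp del: error_potential.simps)
      next
        case (Suc i)
        hence "update st (q, a) = (w, k, i)" using True that by (simp add: st)
        thus ?thesis using u[of i] Suc by simp
      qed
      have "c \<noteq> None" using c False by (auto simp: correct_answer_def)
      moreover have "error_potential v (update st (q, e)) \<le> ?u (L ^ Suc (Suc j))"
      proof (cases "e = None")
        case True': True
        hence "update st (q, e) = (w, k, Suc j)" using True by (simp add: st)
        thus ?thesis using u[of "Suc j"] by simp
      next
        case False
        have "?u (L ^ j) \<le> ?u (L ^ Suc (Suc j))"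
          using d L_gt_1 by (intro add_left_mono divide_right_mono diff_right_mono power_increasing) auto
        thus ?thesis using no[OF False] by linarith
      qed
      ultimately have "(1 - p) * error_potential v (update st (q, c)) + p * error_potential v (update st (q, e))
        \<le> (1 - p) * ?u (L ^ j) + p * ?u (L ^ Suc (Suc j))"
        using no p by (intro add_mono mult_left_mono) auto
      also have "\<dots> = tail (Suc k) + (L ^ j * ((1 - p) + p * L\<^sup>2) - 1) / ?d"
        by (simp add: algebra_simps add_divide_distrib diff_divide_distrib power2_eq_square)
      also have "\<dots> = ?u (L ^ Suc j)" unfolding L_harmonic by (simp add: mult.commute)
      finally show ?thesis unfolding st u .
    qed
  qed
qed

section \<open>The algorithm as a function of the history, and its guarantees\<close>

definition state :: "'a pmf \<Rightarrow> 'a history \<Rightarrow> 'a search_state" where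
  "state \<mu> h = foldl update (pmf \<mu>, 0, 0) h"

definition action :: "'a pmf \<Rightarrow> 'a history \<Rightarrow> 'a action" where
  "action \<mu> h = choose_action (state \<mu> h)"

lemma state_simps: "state \<mu> [] = (pmf \<mu>, 0, 0)" "state \<mu> (h @ [x]) = update (state \<mu> h) x"
  by (simp_all add: state_def)

lemma positive_state:
  assumes "v \<in> set_pmf \<mu>" shows "positive v (fst (state \<mu> h))"
proof (induction h rule: rev_induct)
  case Nil
  show ?case using assms by (simp add: state_simps positive_def pmf_positive)
next
  case (snoc x h)
  thus ?case by (simp add: state_simps positive_update)
qed

text \<open>All three bounds hold for each target of the support separately; only the query bound
  depends on the target, through its self-information.\<close>

lemma run:
  assumes supp: "set_pmf \<mu> \<subseteq> V" and adv: "wf_adversary V E adv" and v: "v \<in> set_pmf \<mu>"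
  defines "alg \<equiv> \<lambda>h. return_pmf (action \<mu> h)"
  shows "(\<integral>\<^sup>+hr. ennreal (term_prob alg adv p v (fst hr) (snd hr)) \<partial>count_space UNIV) = 1"
    and "(\<integral>\<^sup>+hr. ennreal (term_prob alg adv p v (fst hr) (snd hr)) * of_nat (length (fst hr)) \<partial>count_space UNIV)
      \<le> ennreal ((log 2 (1 / pmf \<mu> v) + log 2 (1 / \<delta>) + 1) / info_cap p)"
    and "ennreal (1 - \<delta>) \<le> (\<integral>\<^sup>+h. ennreal (term_prob alg adv p v h v) \<partial>count_space UNIV)"
proof -
  have vV: "v \<in> V" using supp v by auto
  interpret deterministic_run V E p "action \<mu>" adv v
    using conn p adv vV action_in by unfold_locales (auto simp: action_def)
  have I: "0 < info_cap p" by (rule info_cap_pos[OF p])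
  let ?g = "\<lambda>h. time_potential v (state \<mu> h) / info_cap p"
  let ?e = "\<lambda>h. error_potential v (state \<mu> h)"
  have qV: "q \<in> V" if "action \<mu> h = Query q" for h q using act_in[of h] that by simp
  have g: "1 + ((1 - p) * ?g (good h q) + p * ?g (bad h q)) \<le> ?g h" if "action \<mu> h = Query q" for h q
  proof -
    note a = adv_props[OF qV[OF that], of h]
    have "info_cap p + ((1 - p) * time_potential v (state \<mu> (good h q))
        + p * time_potential v (state \<mu> (bad h q))) \<le> time_potential v (state \<mu> h)"
      unfolding good_def bad_def state_simps
      by (rule time_potential_step[OF positive_state[OF v] vV _ a(1,3,4)])
         (use that in \<open>simp add: action_def\<close>)
    from divide_right_mono[OF this, of "info_cap p"] show ?thesis
      using I by (simp add: add_divide_distrib)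
  qed
  have g0: "0 \<le> ?g h" for h
    using time_potential_nonneg[OF positive_state[OF v] vV] I by simp
  have e: "(1 - p) * ?e (good h q) + p * ?e (bad h q) \<le> ?e h" if "action \<mu> h = Query q" for h q
    unfolding good_def bad_def state_simps
    by (rule error_potential_step[OF _ adv_props(1,4)[OF qV[OF that]]])
       (use that in \<open>simp add: action_def\<close>)
  have total: "(\<integral>\<^sup>+h. ennreal (P h * returns h) \<partial>count_space UNIV) = 1"
    by (rule expected_length_le(2)[where g = ?g, OF g g0])
  show "(\<integral>\<^sup>+hr. ennreal (term_prob alg adv p v (fst hr) (snd hr)) \<partial>count_space UNIV) = 1"
    using nn_integral_term[of "\<lambda>_. 1"] total by (simp add: alg_def)
  have "sum (pmf \<mu>) V = 1" using sum_pmf_eq_1[OF finite_V supp] .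
  hence "?g [] \<le> (log 2 (1 / pmf \<mu> v) + log 2 (1 / \<delta>) + 1) / info_cap p"
    using time_potential_start[OF positive_state[OF v, of "[]"] vV, of 0] I
    by (intro divide_right_mono) (simp_all add: state_simps info_def budget_def del: time_potential.simps)
  moreover have "(\<integral>\<^sup>+h. ennreal (P h * (returns h * real (length h))) \<partial>count_space UNIV) \<le> ennreal (?g [])"
    by (rule expected_length_le(1)[where g = ?g, OF g g0])
  moreover have "ennreal (P h * (returns h * real (length h))) = ennreal (P h * returns h) * of_nat (length h)" for h
    by (simp add: ennreal_mult'' ennreal_of_nat_eq_real_of_nat flip: mult.assoc)
  ultimately show "(\<integral>\<^sup>+hr. ennreal (term_prob alg adv p v (fst hr) (snd hr)) * of_nat (length (fst hr)) \<partial>count_space UNIV)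
      \<le> ennreal ((log 2 (1 / pmf \<mu> v) + log 2 (1 / \<delta>) + 1) / info_cap p)"
    using nn_integral_term[of "\<lambda>h. of_nat (length h)"]
    by (auto simp: alg_def intro: order_trans ennreal_leI)
  have "tail 0 = \<delta>" using L_gt_1 by (simp add: tail_def)
  hence "?e [] \<le> \<delta>" using error_potential_start[of v "pmf \<mu>" 0] by (simp add: state_simps del: error_potential.simps)
  hence "ennreal (1 - \<delta>) \<le> ennreal (1 - ?e [])" by (intro ennreal_leI) simp
  also have "\<dots> \<le> (\<integral>\<^sup>+h. ennreal (term_prob alg adv p v h v) \<partial>count_space UNIV)"
    unfolding alg_def using e error_potential_return error_potential_nonneg total
    by (intro success_ge[where g = ?e]) (auto simp: action_def)
  finally show "ennreal (1 - \<delta>) \<le> (\<integral>\<^sup>+h. ennreal (term_prob alg adv p v h v) \<partial>count_space UNIV)" .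
qed

end

theorem theorem2:
  fixes V :: "'a set" and E :: "('a \<times> 'a) set" and \<mu> :: "'a pmf" and p \<delta> :: real
  assumes "connected_graph V E"
    and "0 < p" and "p < 1/2"
    and "0 < \<delta>" and "\<delta> < 1/2"
    and "set_pmf \<mu> \<subseteq> V"
  shows "\<exists>alg :: 'a algorithm. wf_algorithm V alg \<and>
           (\<forall>adv. wf_adversary V E adv \<longrightarrow>
              termination_prob \<mu> alg adv p = 1 \<and>
              expected_queries \<mu> alg adv p
                \<le> ennreal ((entropy_pmf V \<mu> + log 2 (1 / \<delta>) + 1) / info_cap p) \<and>
              success_prob \<mu> alg adv p \<ge> ennreal (1 - \<delta>))"
proof -
  interpret noisy_search V E p \<delta> using assms by unfold_locales auto
  define alg :: "'a algorithm" where "alg = (\<lambda>h. return_pmf (action \<mu> h))"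
  have "wf_algorithm V alg"
    using action_in by (auto simp: wf_algorithm_def alg_def action_def)
  moreover have "termination_prob \<mu> alg adv p = 1 \<and>
      expected_queries \<mu> alg adv p \<le> ennreal ((entropy_pmf V \<mu> + log 2 (1 / \<delta>) + 1) / info_cap p) \<and>
      ennreal (1 - \<delta>) \<le> success_prob \<mu> alg adv p" if adv: "wf_adversary V E adv" for adv
  proof (intro conjI)
    note run = run[OF assms(6) adv, folded alg_def]
    have "termination_prob \<mu> alg adv p = (\<integral>\<^sup>+v. 1 \<partial>measure_pmf \<mu>)"
      unfolding termination_prob_def by (intro nn_integral_cong_AE AE_pmfI run)
    thus "termination_prob \<mu> alg adv p = 1" by (simp add: measure_pmf.emeasure_space_1)
    have "ennreal (1 - \<delta>) = (\<integral>\<^sup>+v. ennreal (1 - \<delta>) \<partial>measure_pmf \<mu>)"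
      by (simp add: measure_pmf.emeasure_space_1)
    also have "\<dots> \<le> success_prob \<mu> alg adv p"
      unfolding success_prob_def by (intro nn_integral_mono_AE AE_pmfI run)
    finally show "ennreal (1 - \<delta>) \<le> success_prob \<mu> alg adv p" .
    define b where "b v = (log 2 (1 / pmf \<mu> v) + log 2 (1 / \<delta>) + 1) / info_cap p" for v
    have I: "0 < info_cap p" by (rule info_cap_pos[OF p])
    have b0: "0 \<le> b v" if "v \<in> set_pmf \<mu>" for v
    proof -
      have "0 \<le> log 2 (1 / pmf \<mu> v)" using pmf_positive[OF that] pmf_le_1[of \<mu> v] by simp
      thus ?thesis using budget_ge[of 0] I by (simp add: b_def budget_def)
    qed
    have fin: "finite (set_pmf \<mu>)" using finite_V assms(6) by (rule finite_subset[rotated])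
    \<comment> \<open>Averaging the self-information over the target produces the entropy.\<close>
    have "expected_queries \<mu> alg adv p \<le> (\<integral>\<^sup>+v. ennreal (b v) \<partial>measure_pmf \<mu>)"
      unfolding expected_queries_def b_def by (intro nn_integral_mono_AE AE_pmfI run)
    also have "\<dots> = (\<Sum>v\<in>set_pmf \<mu>. ennreal (b v) * ennreal (pmf \<mu> v))"
      using fin by (simp add: nn_integral_measure_pmf_finite)
    also have "\<dots> = ennreal (\<Sum>v\<in>set_pmf \<mu>. b v * pmf \<mu> v)"
      using b0 by (subst sum_ennreal[symmetric]) (auto simp: ennreal_mult)
    also have "(\<Sum>v\<in>set_pmf \<mu>. b v * pmf \<mu> v) = (entropy_pmf V \<mu> + log 2 (1 / \<delta>) + 1) / info_cap p"
    proof -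
      have "entropy_pmf V \<mu> = (\<Sum>v\<in>set_pmf \<mu>. pmf \<mu> v * log 2 (1 / pmf \<mu> v))"
        unfolding entropy_pmf_def using finite_V assms(6)
        by (intro sum.mono_neutral_cong_right) (auto simp: set_pmf_iff)
      moreover have "(\<Sum>v\<in>set_pmf \<mu>. pmf \<mu> v) = 1" using fin by (simp add: sum_pmf_eq_1)
      ultimately show ?thesis
        by (simp add: b_def sum.distrib distrib_left add_divide_distrib mult.commute[of _ "pmf _ _"]
            flip: sum_divide_distrib sum_distrib_right)
    qed
    finally show "expected_queries \<mu> alg adv p
      \<le> ennreal ((entropy_pmf V \<mu> + log 2 (1 / \<delta>) + 1) / info_cap p)" .
  qed
  ultimately show ?thesis by blast
qed

end
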